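(* Let $r,s\in\mathbb{C}^*$ be such that $r^ms^n=1$ (with $m,n\in\mathbb{Z}$) implies $m=n=0$, and let $U^+=U^+_{r,s}(G_2)$. Then the first Hochschild cohomology group $HH^1(U^+)$ is a two-dimensional complex vector space spanned by the classes $\overline{D_5},\overline{D_6}$ of the derivations $D_5,D_6$.
   Context: $\mathbb{C}^*=\mathbb{C}\setminus\{0\}$. $U^+=U^+_{r,s}(G_2)$ is the associative unital $\mathbb{C}$-algebra generated by $e_1,e_2$ subject to the relations $$e_2^2e_1-(r^{-3}+s^{-3})e_2e_1e_2+(rs)^{-3}e_1e_2^2=0,$$ $$e_1^4e_2-(r+s)(r^2+s^2)e_1^3e_2e_1+rs(r^2+s^2)(r^2+rs+s^2)e_1^2e_2e_1^2-(rs)^3(r+s)(r^2+s^2)e_1e_2e_1^3+(rs)^6e_2e_1^4=0.$$ Put $X_1=e_1$, $X_6=e_2$, $X_5=e_1e_2-s^3e_2e_1$, $X_3=e_1X_5-rs^2X_5e_1$, $X_2=e_1X_3-r^2sX_3e_1$, $X_4=X_3X_5-r^2sX_5X_3$. $HH^1(U^+):=\mathrm{Der}(U^+)/\mathrm{InnDer}(U^+)$, where $\mathrm{Der}(U^+)$ is the space of $\mathbb{C}$-derivations of $U^+$ and $\mathrm{InnDer}(U^+)=\{\mathrm{ad}_g\mid g\in U^+\}$, $\mathrm{ad}_g(x)=gx-xg$. $D_5$ and $D_6$ are the derivations of $U^+$ determined by $D_5(X_1)=X_1$, $D_5(X_2)=3X_2$, $D_5(X_3)=2X_3$, $D_5(X_4)=3X_4$,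 $D_5(X_5)=X_5$, $D_5(X_6)=0$; $D_6(X_1)=-X_1$, $D_6(X_2)=-2X_2$, $D_6(X_3)=-X_3$, $D_6(X_4)=-X_4$, $D_6(X_5)=0$, $D_6(X_6)=X_6$. *)

theory Defs
  imports
    "Jordan_Normal_Form.VS_Connect"
    "HOL-Algebra.QuotRing"
    "HOL-Library.Poly_Mapping"
begin

section \<open>Derivations and first Hochschild cohomology\<close>

text \<open>
  An associative unital, not necessarily commutative algebra over \<open>K\<close> is represented by a
  \<^typ>\<open>('k, 'a) module\<close> record all of whose fields are used. (The locale \<^locale>\<open>algebra\<close> of
  the library demands commutativity.) When such a record represents a mere vector space, the
  fields \<^const>\<open>mult\<close> and \<^const>\<open>one\<close> carry no information.
\<close>

text \<open>
  The quotient by a submodule \<open>N\<close>; it is the quotient algebra if \<open>N\<close> is a two-sided ideal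
  of an algebra. The scalar action sends \<open>N + x\<close> to \<open>N + c x\<close>, in the style of
  \<^const>\<open>rcoset_mult\<close>.
\<close>

definition quot_module :: "('k, 'a, 'c) module_scheme \<Rightarrow> 'a set \<Rightarrow> ('k, 'a set) module" where
  "quot_module M N =
    ring.extend (M Quot N) (module.fields (\<lambda>c X. \<Union>x\<in>X. N +>\<^bsub>M\<^esub> (c \<odot>\<^bsub>M\<^esub> x)))"

text \<open>
  Derivations are made extensional, so that two of them are equal as HOL functions if and only
  if they agree on the algebra.
\<close>

definition derivations :: "('k, 'd) ring_scheme \<Rightarrow> ('k, 'a, 'c) module_scheme \<Rightarrow> ('a \<Rightarrow> 'a) set" where
  "derivations K A = {D \<in> LinearCombinations.module_hom K A A \<inter> extensional (carrier A).
     \<forall>x\<in>carrier A. \<forall>y\<in>carrier A.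
       D (x \<otimes>\<^bsub>A\<^esub> y) = (D x \<otimes>\<^bsub>A\<^esub> y) \<oplus>\<^bsub>A\<^esub> (x \<otimes>\<^bsub>A\<^esub> D y)}"

definition der_module ::
  "('k, 'd) ring_scheme \<Rightarrow> ('k, 'a, 'c) module_scheme \<Rightarrow> ('k, 'a \<Rightarrow> 'a) module" where
  "der_module K A =
    \<lparr>carrier = derivations K A,
     mult = undefined,
     one = undefined,
     zero = (\<lambda>x\<in>carrier A. \<zero>\<^bsub>A\<^esub>),
     add = (\<lambda>D E. \<lambda>x\<in>carrier A. D x \<oplus>\<^bsub>A\<^esub> E x),
     smult = (\<lambda>c D. \<lambda>x\<in>carrier A. c \<odot>\<^bsub>A\<^esub> D x)\<rparr>"

definition inner_der :: "('k, 'a, 'c) module_scheme \<Rightarrow> 'a \<Rightarrow> 'a \<Rightarrow> 'a" where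
  "inner_der A g = (\<lambda>x\<in>carrier A. (g \<otimes>\<^bsub>A\<^esub> x) \<ominus>\<^bsub>A\<^esub> (x \<otimes>\<^bsub>A\<^esub> g))"

definition inner_derivations :: "('k, 'a, 'c) module_scheme \<Rightarrow> ('a \<Rightarrow> 'a) set" where
  "inner_derivations A = inner_der A ` carrier A"

definition HH1 ::
  "('k, 'd) ring_scheme \<Rightarrow> ('k, 'a, 'c) module_scheme \<Rightarrow> ('k, ('a \<Rightarrow> 'a) set) module" where
  "HH1 K A = quot_module (der_module K A) (inner_derivations A)"

definition HH1_class ::
  "('k, 'd) ring_scheme \<Rightarrow> ('k, 'a, 'c) module_scheme \<Rightarrow> ('a \<Rightarrow> 'a) \<Rightarrow> ('a \<Rightarrow> 'a) set" where
  "HH1_class K A D = inner_derivations A +>\<^bsub>der_module K A\<^esub> D"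


section \<open>The free complex algebra on two generators\<close>

datatype gen = Gen1 | Gen2

text \<open>
  The free monoid, written additively: \<^const>\<open>plus\<close> is concatenation. Then the ring structure
  that \<^theory>\<open>HOL-Library.Poly_Mapping\<close> puts on finitely supported functions is that of
  the monoid algebra, i.e. of the free algebra.
\<close>

datatype word = Word (letters: "gen list")

instantiation word :: monoid_add
begin

definition zero_word :: word where
  "zero_word = Word []"

definition plus_word :: "word \<Rightarrow> word \<Rightarrow> word" where
  "plus_word v w = Word (letters v @ letters w)"

instance
  by standard (simp_all add: zero_word_def plus_word_def)

end

type_synonym free_alg = "word \<Rightarrow>\<^sub>0 complex"

definition scale :: "complex \<Rightarrow> free_alg \<Rightarrow> free_alg" where
  "scale c p = Poly_Mapping.single 0 c * p"

definition free_algebra :: "(complex, free_alg) module" where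
  "free_algebra =
    \<lparr>carrier = UNIV, mult = (*), one = 1, zero = 0, add = (+), smult = scale\<rparr>"

definition e1 :: free_alg where
  "e1 = Poly_Mapping.single (Word [Gen1]) 1"

definition e2 :: free_alg where
  "e2 = Poly_Mapping.single (Word [Gen2]) 1"


section \<open>The algebra \<open>U\<^sup>+\<close> of type \<open>G\<^sub>2\<close>\<close>

definition serre21 :: "complex \<Rightarrow> complex \<Rightarrow> free_alg" where
  "serre21 r s =
     e2^2 * e1
     - scale (r powi (-3) + s powi (-3)) (e2 * e1 * e2)
     + scale ((r * s) powi (-3)) (e1 * e2^2)"

definition serre12 :: "complex \<Rightarrow> complex \<Rightarrow> free_alg" where
  "serre12 r s =
     e1^4 * e2
     - scale ((r + s) * (r^2 + s^2)) (e1^3 * e2 * e1)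
     + scale (r * s * (r^2 + s^2) * (r^2 + r * s + s^2)) (e1^2 * e2 * e1^2)
     - scale ((r * s)^3 * (r + s) * (r^2 + s^2)) (e1 * e2 * e1^3)
     + scale ((r * s)^6) (e2 * e1^4)"

definition rel_ideal :: "complex \<Rightarrow> complex \<Rightarrow> free_alg set" where
  "rel_ideal r s = genideal free_algebra {serre21 r s, serre12 r s}"

definition Uplus :: "complex \<Rightarrow> complex \<Rightarrow> (complex, free_alg set) module" where
  "Uplus r s = quot_module free_algebra (rel_ideal r s)"

definition X1 :: "complex \<Rightarrow> complex \<Rightarrow> free_alg set" where
  "X1 r s = rel_ideal r s +>\<^bsub>free_algebra\<^esub> e1"

definition X6 :: "complex \<Rightarrow> complex \<Rightarrow> free_alg set" where
  "X6 r s = rel_ideal r s +>\<^bsub>free_algebra\<^esub> e2"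

text \<open>The skew commutator \<open>x y - c y x\<close>.\<close>

definition skew_comm :: "('k, 'a, 'c) module_scheme \<Rightarrow> 'k \<Rightarrow> 'a \<Rightarrow> 'a \<Rightarrow> 'a" where
  "skew_comm A c x y = (x \<otimes>\<^bsub>A\<^esub> y) \<ominus>\<^bsub>A\<^esub> (c \<odot>\<^bsub>A\<^esub> (y \<otimes>\<^bsub>A\<^esub> x))"

definition X5 :: "complex \<Rightarrow> complex \<Rightarrow> free_alg set" where
  "X5 r s = skew_comm (Uplus r s) (s^3) (X1 r s) (X6 r s)"

definition X3 :: "complex \<Rightarrow> complex \<Rightarrow> free_alg set" where
  "X3 r s = skew_comm (Uplus r s) (r * s^2) (X1 r s) (X5 r s)"

definition X2 :: "complex \<Rightarrow> complex \<Rightarrow> free_alg set" where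
  "X2 r s = skew_comm (Uplus r s) (r^2 * s) (X1 r s) (X3 r s)"

definition X4 :: "complex \<Rightarrow> complex \<Rightarrow> free_alg set" where
  "X4 r s = skew_comm (Uplus r s) (r^2 * s) (X3 r s) (X5 r s)"

definition is_D5 :: "complex \<Rightarrow> complex \<Rightarrow> (free_alg set \<Rightarrow> free_alg set) \<Rightarrow> bool" where
  "is_D5 r s D \<longleftrightarrow> D \<in> derivations class_ring (Uplus r s) \<and>
     D (X1 r s) = X1 r s \<and>
     D (X2 r s) = 3 \<odot>\<^bsub>Uplus r s\<^esub> X2 r s \<and>
     D (X3 r s) = 2 \<odot>\<^bsub>Uplus r s\<^esub> X3 r s \<and>
     D (X4 r s) = 3 \<odot>\<^bsub>Uplus r s\<^esub> X4 r s \<and>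
     D (X5 r s) = X5 r s \<and>
     D (X6 r s) = \<zero>\<^bsub>Uplus r s\<^esub>"

definition is_D6 :: "complex \<Rightarrow> complex \<Rightarrow> (free_alg set \<Rightarrow> free_alg set) \<Rightarrow> bool" where
  "is_D6 r s D \<longleftrightarrow> D \<in> derivations class_ring (Uplus r s) \<and>
     D (X1 r s) = (-1) \<odot>\<^bsub>Uplus r s\<^esub> X1 r s \<and>
     D (X2 r s) = (-2) \<odot>\<^bsub>Uplus r s\<^esub> X2 r s \<and>
     D (X3 r s) = (-1) \<odot>\<^bsub>Uplus r s\<^esub> X3 r s \<and>
     D (X4 r s) = (-1) \<odot>\<^bsub>Uplus r s\<^esub> X4 r s \<and>
     D (X5 r s) = \<zero>\<^bsub>Uplus r s\<^esub> \<and>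
     D (X6 r s) = X6 r s"

text \<open>
  These descriptions are only meaningful once unique existence has been shown, so a statement
  about \<open>D5\<close> and \<open>D6\<close> should include it.
\<close>

definition D5 :: "complex \<Rightarrow> complex \<Rightarrow> free_alg set \<Rightarrow> free_alg set" where
  "D5 r s = (THE D. is_D5 r s D)"

definition D6 :: "complex \<Rightarrow> complex \<Rightarrow> free_alg set \<Rightarrow> free_alg set" where
  "D6 r s = (THE D. is_D6 r s D)"

end

theory Submission
  imports Defs "HOL-Library.Product_Plus"
begin

text \<open>
  Why the theorem holds. Let \<open>X\<^sub>1, \<dots>, X\<^sub>6\<close> be the root vectors. They satisfy straightening
  relations \<open>X\<^sub>i X\<^sub>j = q\<^sub>i\<^sub>j X\<^sub>j X\<^sub>i + lower terms\<close>, where each \<open>q\<^sub>i\<^sub>j\<close> is a monomial in \<open>r\<^sup>\<plusminus>\<^sup>1\<close> and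
  \<open>s\<^sup>\<plusminus>\<^sup>1\<close>, and lower terms are those of smaller total weight for the weights
  \<open>3, 3, 1, 1, 1, 3\<close> of \<open>X\<^sub>1, \<dots>, X\<^sub>6\<close>. So the algebra is filtered and its associated graded algebra is a quantum affine space: monomials \<open>T\<^sup>a\<close> with \<open>a \<in> \<nat>\<^sup>6\<close> which
  commute up to the scalars \<open>\<chi>(a, b)\<close> of a bicharacter \<open>\<chi>\<close>.

  Let \<open>D\<close> be a derivation that raises weights by at most \<open>N\<close>. Applying \<open>D\<close> to the straightening
  relation of \<open>X\<^sub>i\<close> and \<open>X\<^sub>j\<close> and comparing the top coefficients shows that the suitably normalised
  coefficient \<open>\<kappa>\<^sub>i(l)\<close> of \<open>T\<^bsup>l + \<epsilon>\<^sub>i\<^esup>\<close> in \<open>D(X\<^sub>i)\<close> satisfies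
  \<open>\<kappa>\<^sub>i(l) (\<chi>(l, \<epsilon>\<^sub>j) - 1) = \<kappa>\<^sub>j(l) (\<chi>(l, \<epsilon>\<^sub>i) - 1)\<close> for every \<open>l \<in> \<int>\<^sup>6\<close> of weight \<open>N\<close>
  (\<open>top_coeff_relation\<close>). Because \<open>r\<close> and \<open>s\<close> are multiplicatively independent, \<open>T\<^sup>l\<close> with
  \<open>l \<noteq> 0\<close> cannot even commute with five of the six generators (\<open>comm_factor_trivial\<close>). If \<open>l\<close> has a
  negative entry then \<open>\<kappa>\<^sub>i(l) \<noteq> 0\<close> for at most one \<open>i\<close>, and the relation makes this one vanish
  too. If \<open>l \<in> \<nat>\<^sup>6\<close> is nonzero, the relation says that the family \<open>(\<kappa>\<^sub>i(l))\<^sub>i\<close> is the one of a multiple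
  of \<open>ad (T\<^sup>l)\<close>. Finally \<open>l = 0\<close> belongs to the part of \<open>D\<close> that preserves the \<open>\<nat>\<^sup>2\<close>-degree; as
  \<open>e\<^sub>1\<close> and \<open>e\<^sub>2\<close> span their degrees, this part is a combination of \<open>D\<^sub>5\<close> and \<open>D\<^sub>6\<close> and can be subtracted
  in advance. Hence an inner derivation can be subtracted from \<open>D\<close> so that \<open>N\<close> drops
  (\<open>descent_step\<close>), and this can be repeated until \<open>D\<close> vanishes (\<open>mod_der_decomposition\<close>).
  A combination of \<open>D\<^sub>5\<close> and \<open>D\<^sub>6\<close> that is inner is zero, since the part of \<open>ad g\<close> of degree
  zero comes from the constant term of \<open>g\<close>, which is central.

  To speak of top coefficients one needs that the ordered monomials in the \<open>X\<^sub>i\<close> are linearly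
  independent. This is provided by a representation in a quantum torus with generators
  \<open>T\<^sub>1, \<dots>, T\<^sub>6\<close> in which \<open>e\<^sub>2\<close> acts as \<open>T\<^sub>6\<close>, \<open>e\<^sub>1\<close> acts as a sum of six Laurent monomials, and every \<open>X\<^sub>i\<close>
  acts as a nonzero multiple of \<open>T\<^sub>i\<close> plus terms of lower weight (\<open>rep_root_vec_lead\<close>).

  All computations take place in the free algebra modulo the ideal of the relations; a derivation
  of \<open>U\<^sup>+\<close> is handled through an arbitrary lift to a map of the free algebra.
\<close>

section \<open>Quotient modules\<close>

lemma quot_module_sel:
  "carrier (quot_module M N) = a_rcosets\<^bsub>M\<^esub> N"
  "mult (quot_module M N) = rcoset_mult M N"
  "zero (quot_module M N) = N"
  "add (quot_module M N) = set_add M"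
  "smult (quot_module M N) = (\<lambda>c Y. \<Union>x\<in>Y. N +>\<^bsub>M\<^esub> (c \<odot>\<^bsub>M\<^esub> x))"
  by (simp_all add: quot_module_def ring.defs module.defs FactRing_def)

context
  fixes K :: "('k, 'e) ring_scheme" and M :: "('k, 'a, 'c) module_scheme" and N :: "'a set"
  assumes M: "Module.module K M" and N: "submodule K N M"
begin

interpretation Module.module K M by (rule M)

lemma abelian_subgroup_submodule: "abelian_subgroup N M"
proof (rule abelian_subgroupI3)
  have sub: "N \<subseteq> carrier M" using submodule.subset[OF N] .
  show "additive_subgroup N M"
  proof (rule additive_subgroup.intro, rule M.add.subgroupI)
    show "N \<noteq> {}" using submodule.zero_closed[OF N] by auto
    fix x assume x: "x \<in> N"
    then have "(\<ominus>\<^bsub>K\<^esub> \<one>\<^bsub>K\<^esub>) \<odot>\<^bsub>M\<^esub> x \<in> N" by (intro submodule.smult_closed[OF N]) auto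
    moreover have "x \<in> carrier M" using x sub by auto
    then have "(\<ominus>\<^bsub>K\<^esub> \<one>\<^bsub>K\<^esub>) \<odot>\<^bsub>M\<^esub> x = \<ominus>\<^bsub>M\<^esub> x"
      using smult_l_minus[of "\<one>\<^bsub>K\<^esub>" x] by simp
    ultimately show "\<ominus>\<^bsub>M\<^esub> x \<in> N" by simp
  qed (use sub submodule.m_closed[OF N] in auto)
  show "abelian_group M" by (rule M.abelian_group_axioms)
qed

interpretation N: abelian_subgroup N M by (rule abelian_subgroup_submodule)

lemma quot_carrier: "carrier (quot_module M N) = (\<lambda>x. N +>\<^bsub>M\<^esub> x) ` carrier M"
  by (auto simp: quot_module_sel A_RCOSETS_def')

lemma quot_eq_iff:
  assumes "x \<in> carrier M" "y \<in> carrier M"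
  shows "N +>\<^bsub>M\<^esub> x = N +>\<^bsub>M\<^esub> y \<longleftrightarrow> x \<ominus>\<^bsub>M\<^esub> y \<in> N"
proof -
  have "x \<in> N +>\<^bsub>M\<^esub> y \<longleftrightarrow> x \<ominus>\<^bsub>M\<^esub> y \<in> N"
    using N.a_rcos_module[OF assms(2,1)] by (simp add: a_minus_def)
  moreover have "N +>\<^bsub>M\<^esub> x = N +>\<^bsub>M\<^esub> y \<longleftrightarrow> x \<in> N +>\<^bsub>M\<^esub> y"
    using N.a_rcos_self[OF assms(1)] M.a_repr_independence[OF _ assms(2) N.a_subgroup, of x] by auto
  ultimately show ?thesis by simp
qed

lemma quot_zero: "\<zero>\<^bsub>quot_module M N\<^esub> = N +>\<^bsub>M\<^esub> \<zero>\<^bsub>M\<^esub>"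
  by (simp add: quot_module_sel M.a_coset_add_zero submodule.subset[OF N])

lemma quot_add:
  "x \<in> carrier M \<Longrightarrow> y \<in> carrier M \<Longrightarrow>
    (N +>\<^bsub>M\<^esub> x) \<oplus>\<^bsub>quot_module M N\<^esub> (N +>\<^bsub>M\<^esub> y) = N +>\<^bsub>M\<^esub> (x \<oplus>\<^bsub>M\<^esub> y)"
  by (simp add: quot_module_sel N.a_rcos_sum)

lemma quot_smult:
  assumes c: "c \<in> carrier K" and x: "x \<in> carrier M"
  shows "c \<odot>\<^bsub>quot_module M N\<^esub> (N +>\<^bsub>M\<^esub> x) = N +>\<^bsub>M\<^esub> (c \<odot>\<^bsub>M\<^esub> x)"
proof -
  have *: "N +>\<^bsub>M\<^esub> (c \<odot>\<^bsub>M\<^esub> y) = N +>\<^bsub>M\<^esub> (c \<odot>\<^bsub>M\<^esub> x)" if y: "y \<in> N +>\<^bsub>M\<^esub> x" for y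
  proof -
    obtain n where n: "n \<in> N" "y = n \<oplus>\<^bsub>M\<^esub> x" using y by (auto simp: a_r_coset_def')
    then have nM: "n \<in> carrier M" using submodule.subset[OF N] by auto
    have "c \<odot>\<^bsub>M\<^esub> y \<ominus>\<^bsub>M\<^esub> c \<odot>\<^bsub>M\<^esub> x = c \<odot>\<^bsub>M\<^esub> n"
      using c x nM n(2) by (simp add: smult_r_distr a_minus_def M.a_assoc M.r_neg)
    also have "\<dots> \<in> N" using n(1) c by (intro submodule.smult_closed[OF N])
    finally show ?thesis using c x nM n(2) by (subst quot_eq_iff) auto
  qed
  have "(\<Union>y\<in>N +>\<^bsub>M\<^esub> x. N +>\<^bsub>M\<^esub> (c \<odot>\<^bsub>M\<^esub> y)) = (\<Union>y\<in>N +>\<^bsub>M\<^esub> x. N +>\<^bsub>M\<^esub> (c \<odot>\<^bsub>M\<^esub> x))"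
    by (rule SUP_cong[OF refl *])
  also have "\<dots> = N +>\<^bsub>M\<^esub> (c \<odot>\<^bsub>M\<^esub> x)" using N.a_rcos_self[OF x] by blast
  finally show ?thesis by (simp only: quot_module_sel)
qed

lemma module_quot_module: "Module.module K (quot_module M N)"
proof (rule module_criteria)
  show "cring K" by (rule R.cring_axioms)
  show "\<forall>v\<in>carrier (quot_module M N). \<exists>w\<in>carrier (quot_module M N).
      v \<oplus>\<^bsub>quot_module M N\<^esub> w = \<zero>\<^bsub>quot_module M N\<^esub>"
  proof
    fix v assume "v \<in> carrier (quot_module M N)"
    then obtain x where x: "x \<in> carrier M" "v = N +>\<^bsub>M\<^esub> x" by (auto simp: quot_carrier)
    then show "\<exists>w\<in>carrier (quot_module M N). v \<oplus>\<^bsub>quot_module M N\<^esub> w = \<zero>\<^bsub>quot_module M N\<^esub>"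
      by (intro bexI[of _ "N +>\<^bsub>M\<^esub> (\<ominus>\<^bsub>M\<^esub> x)"])
        (auto simp: quot_carrier quot_add quot_zero M.r_neg)
  qed
qed (auto simp: quot_carrier quot_add quot_zero quot_smult M.a_ac
    smult_l_distr smult_r_distr smult_assoc1)

end

section \<open>The free algebra\<close>

lemma free_alg_induct [case_names zero add]:
  fixes p :: free_alg
  assumes "P 0" and "\<And>w c p. P p \<Longrightarrow> P (Poly_Mapping.single w c + p)"
  shows "P p"
proof -
  have *: "P (\<Sum>w\<in>S. Poly_Mapping.single w (Poly_Mapping.lookup p w))" if "finite S" for S
    using that by (induction S rule: finite_induct) (auto intro: assms)
  have "p = (\<Sum>w\<in>Poly_Mapping.keys p. Poly_Mapping.single w (Poly_Mapping.lookup p w))"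
    by (rule poly_mapping_eqI)
      (simp add: lookup_sum lookup_single when_def in_keys_iff)
  then show ?thesis using *[of "Poly_Mapping.keys p"] by simp
qed

lemma scalar_central: "Poly_Mapping.single 0 c * p = p * Poly_Mapping.single 0 c"
  for p :: free_alg
  by (induction p rule: free_alg_induct) (simp_all add: algebra_simps mult_single)

lemma scale_single: "scale c (Poly_Mapping.single w d) = Poly_Mapping.single w (c * d)"
  by (simp add: scale_def mult_single)

lemma scale_add_right: "scale c (p + q) = scale c p + scale c q"
  by (simp add: scale_def algebra_simps)

lemma scale_diff_right: "scale c (p - q) = scale c p - scale c q"
  by (simp add: scale_def algebra_simps)

lemma scale_add_left: "scale (c + d) p = scale c p + scale d p"
  by (simp add: scale_def algebra_simps single_add)

lemma scale_diff_left: "scale (c - d) p = scale c p - scale d p"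
  by (simp add: scale_def algebra_simps single_diff)

lemma scale_scale [simp]: "scale c (scale d p) = scale (c * d) p"
  by (simp add: scale_def mult_single flip: mult.assoc)

lemma scale_one [simp]: "scale 1 p = p"
  by (simp add: scale_def)

lemma scale_zero_left [simp]: "scale 0 p = 0"
  by (simp add: scale_def)

lemma scale_zero_right [simp]: "scale c 0 = 0"
  by (simp add: scale_def)

lemma scale_minus_left: "scale (- c) p = - scale c p"
  using scale_diff_left[of 0 c p] by simp

lemma scale_mult_left: "scale c p * q = scale c (p * q)"
  by (simp add: scale_def mult.assoc)

lemma scale_mult_right: "p * scale c q = scale c (p * q)"
  by (metis scale_def scalar_central mult.assoc)

lemma lookup_scale: "Poly_Mapping.lookup (scale c p) w = c * Poly_Mapping.lookup p w"
  by (induction p rule: free_alg_induct)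
    (simp_all add: scale_add_right scale_single lookup_add lookup_single when_def algebra_simps)

lemma scale_sum: "scale c (\<Sum>a\<in>A. f a) = (\<Sum>a\<in>A. scale c (f a))"
  by (simp add: scale_def sum_distrib_left)

lemma word_induct [case_names zero Gen1 Gen2]:
  assumes "P 0" "\<And>w. P w \<Longrightarrow> P (Word [Gen1] + w)" "\<And>w. P w \<Longrightarrow> P (Word [Gen2] + w)"
  shows "P w"
proof (induction "letters w" arbitrary: w)
  case Nil
  then have "w = 0" by (cases w) (auto simp: zero_word_def)
  with assms(1) show ?case by simp
next
  case (Cons g gs)
  then have "w = Word [g] + Word gs" by (cases w) (auto simp: plus_word_def)
  with Cons(1)[of "Word gs"] assms(2,3) show ?case by (cases g) auto
qed

text \<open>Statements closed under the algebra operations only have to be checked on \<open>e\<^sub>1\<close> and \<open>e\<^sub>2\<close>.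
  This is used for maps on the free algebra that are determined by their values on generators.\<close>

lemma free_alg_generated:
  assumes one: "1 \<in> S" and "e1 \<in> S" "e2 \<in> S"
    and add: "\<And>p q. p \<in> S \<Longrightarrow> q \<in> S \<Longrightarrow> p + q \<in> S"
    and mult: "\<And>p q. p \<in> S \<Longrightarrow> q \<in> S \<Longrightarrow> p * q \<in> S"
    and scale: "\<And>c p. p \<in> S \<Longrightarrow> scale c p \<in> S"
  shows "p \<in> S"
proof -
  have w: "Poly_Mapping.single w 1 \<in> S" for w
  proof (induction w rule: word_induct)
    case zero then show ?case using one by simp
  next
    case (Gen1 w)
    have "Poly_Mapping.single (Word [Gen1] + w) 1 = e1 * Poly_Mapping.single w 1"
      by (simp add: e1_def mult_single)
    with mult[OF assms(2) Gen1] show ?case by simp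
  next
    case (Gen2 w)
    have "Poly_Mapping.single (Word [Gen2] + w) 1 = e2 * Poly_Mapping.single w 1"
      by (simp add: e2_def mult_single)
    with mult[OF assms(3) Gen2] show ?case by simp
  qed
  have wc: "Poly_Mapping.single w c \<in> S" for w c
    using scale[OF w, of c w] by (simp add: scale_single)
  show ?thesis
  proof (induction p rule: free_alg_induct)
    case zero then show ?case using scale[OF one, of 0] by simp
  next
    case (add w c p) then show ?case using wc assms(4) by blast
  qed
qed

section \<open>Two-sided ideals\<close>

lemma free_algebra_sel [simp]:
  "carrier free_algebra = UNIV" "mult free_algebra = (*)" "one free_algebra = 1"
  "zero free_algebra = 0" "add free_algebra = (+)" "smult free_algebra = scale"
  by (simp_all add: free_algebra_def)

lemma ring_free_algebra: "ring free_algebra"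
proof (rule ringI)
  show "abelian_group free_algebra"
  proof (rule abelian_groupI)
    fix x show "\<exists>y\<in>carrier free_algebra. y \<oplus>\<^bsub>free_algebra\<^esub> x = \<zero>\<^bsub>free_algebra\<^esub>"
      by (rule bexI[of _ "- x"]) auto
  qed (auto simp: add_ac)
  show "monoid free_algebra" by (rule monoidI) (auto simp: mult_ac)
qed (auto simp: algebra_simps)

lemma a_inv_free_algebra: "\<ominus>\<^bsub>free_algebra\<^esub> x = - x"
proof -
  interpret ring free_algebra by (rule ring_free_algebra)
  show ?thesis by (rule minus_equality) auto
qed

lemma cring_class: "cring (class_ring :: complex ring)"
  by (rule domain.axioms(1)[OF field.axioms(1)[OF class_field]])

lemma module_free_algebra: "Module.module class_ring free_algebra"
proof (rule module_criteria)
  show "cring (class_ring :: complex ring)" by (rule cring_class)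
  show "\<forall>v\<in>carrier free_algebra. \<exists>w\<in>carrier free_algebra. v \<oplus>\<^bsub>free_algebra\<^esub> w = \<zero>\<^bsub>free_algebra\<^esub>"
    by (auto intro: exI[of _ "- _"])
qed (auto simp: add_ac scale_add_left scale_add_right)

lemma ideal_free_algebraI:
  assumes "0 \<in> J" "\<And>x y. x \<in> J \<Longrightarrow> y \<in> J \<Longrightarrow> x + y \<in> J" "\<And>x. x \<in> J \<Longrightarrow> - x \<in> J"
    "\<And>x p. x \<in> J \<Longrightarrow> p * x \<in> J" "\<And>x p. x \<in> J \<Longrightarrow> x * p \<in> J"
  shows "ideal J free_algebra"
proof (rule idealI[OF ring_free_algebra])
  interpret ring free_algebra by (rule ring_free_algebra)
  show "subgroup J (add_monoid free_algebra)"
    by (rule add.subgroupI) (use assms a_inv_free_algebra in \<open>auto simp flip: a_inv_def\<close>)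
qed (use assms in auto)

lemma ideal_rel_ideal: "ideal (rel_ideal r s) free_algebra"
  unfolding rel_ideal_def by (rule ring.genideal_ideal[OF ring_free_algebra]) auto

text \<open>Modulo the relations, everything below relies on these closure properties alone.\<close>

lemma
  shows rel_zero [simp]: "0 \<in> rel_ideal r s"
    and rel_add: "x \<in> rel_ideal r s \<Longrightarrow> y \<in> rel_ideal r s \<Longrightarrow> x + y \<in> rel_ideal r s"
    and rel_minus: "x \<in> rel_ideal r s \<Longrightarrow> - x \<in> rel_ideal r s"
    and rel_mult_left: "x \<in> rel_ideal r s \<Longrightarrow> p * x \<in> rel_ideal r s"
    and rel_mult_right: "x \<in> rel_ideal r s \<Longrightarrow> x * p \<in> rel_ideal r s"
proof -
  interpret ideal "rel_ideal r s" free_algebra by (rule ideal_rel_ideal)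
  show "0 \<in> rel_ideal r s" using additive_subgroup.zero_closed[OF additive_subgroup_axioms] by simp
  show "x \<in> rel_ideal r s \<Longrightarrow> y \<in> rel_ideal r s \<Longrightarrow> x + y \<in> rel_ideal r s"
    using additive_subgroup.a_closed[OF additive_subgroup_axioms] by simp
  show "x \<in> rel_ideal r s \<Longrightarrow> - x \<in> rel_ideal r s"
    using additive_subgroup.a_inv_closed[OF additive_subgroup_axioms] by (simp add: a_inv_free_algebra)
  show "x \<in> rel_ideal r s \<Longrightarrow> p * x \<in> rel_ideal r s" using I_l_closed by simp
  show "x \<in> rel_ideal r s \<Longrightarrow> x * p \<in> rel_ideal r s" using I_r_closed by simp
qed

lemma rel_diff: "x \<in> rel_ideal r s \<Longrightarrow> y \<in> rel_ideal r s \<Longrightarrow> x - y \<in> rel_ideal r s"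
  using rel_add[of x r s "- y"] rel_minus by simp

lemma rel_scale: "x \<in> rel_ideal r s \<Longrightarrow> scale c x \<in> rel_ideal r s"
  by (simp add: scale_def rel_mult_left)

lemma serre_in_rel: "serre21 r s \<in> rel_ideal r s" "serre12 r s \<in> rel_ideal r s"
  using ring.genideal_self[OF ring_free_algebra, of "{serre21 r s, serre12 r s}"]
  by (auto simp: rel_ideal_def)

text \<open>The way in which the relations enter from outside: a property that forms an ideal and
  holds for the two Serre elements holds for all relations.\<close>

lemma rel_ideal_least:
  assumes "ideal J free_algebra" "serre21 r s \<in> J" "serre12 r s \<in> J"
  shows "rel_ideal r s \<subseteq> J"
  unfolding rel_ideal_def using assms
  by (intro ring.genideal_minimal[OF ring_free_algebra]) auto

section \<open>The degree derivations\<close>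

text \<open>Words are eigenvectors of this map; it is a derivation as soon as the weight is additive.\<close>

definition weight_der :: "(word \<Rightarrow> complex) \<Rightarrow> free_alg \<Rightarrow> free_alg" where
  "weight_der n p = Poly_Mapping.mapp (\<lambda>w c. n w * c) p"

lemma lookup_weight_der: "Poly_Mapping.lookup (weight_der n p) w = n w * Poly_Mapping.lookup p w"
  by (simp add: weight_der_def lookup_mapp when_def in_keys_iff)

lemma weight_der_add: "weight_der n (p + q) = weight_der n p + weight_der n q"
  by (rule poly_mapping_eqI) (simp add: lookup_weight_der lookup_add algebra_simps)

lemma weight_der_zero [simp]: "weight_der n 0 = 0"
  by (rule poly_mapping_eqI) (simp add: lookup_weight_der)

lemma weight_der_single: "weight_der n (Poly_Mapping.single w c) = Poly_Mapping.single w (n w * c)"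
  by (rule poly_mapping_eqI) (simp add: lookup_weight_der lookup_single when_def)

lemma weight_der_scale: "weight_der n (scale c p) = scale c (weight_der n p)"
  by (rule poly_mapping_eqI) (simp add: lookup_weight_der lookup_scale)

lemma weight_der_minus: "weight_der n (- p) = - weight_der n p"
  by (rule poly_mapping_eqI) (simp add: lookup_weight_der)

lemma weight_der_diff: "weight_der n (p - q) = weight_der n p - weight_der n q"
  by (rule poly_mapping_eqI) (simp add: lookup_weight_der lookup_minus algebra_simps)

lemma weight_der_mult:
  assumes "\<And>v w. n (v + w) = n v + n w"
  shows "weight_der n (p * q) = weight_der n p * q + p * weight_der n q"
proof (induction p rule: free_alg_induct)
  case (add v c p)
  have "weight_der n (Poly_Mapping.single v c * q)
      = weight_der n (Poly_Mapping.single v c) * q + Poly_Mapping.single v c * weight_der n q"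
    by (induction q rule: free_alg_induct)
      (simp_all add: algebra_simps mult_single weight_der_add weight_der_single assms single_add)
  with add show ?case by (simp add: algebra_simps weight_der_add)
qed simp

text \<open>All gradings that occur are special cases. The weights \<open>(1, 0)\<close> and \<open>(-1, 1)\<close> lead to \<open>D\<^sub>5\<close> and
  \<open>D\<^sub>6\<close>, while \<open>(1, \<i>)\<close> encodes the \<open>\<nat>\<^sup>2\<close>-degree in a single complex number.\<close>

definition deg_weight :: "complex \<Rightarrow> complex \<Rightarrow> word \<Rightarrow> complex" where
  "deg_weight a b w = sum_list (List.map (case_gen a b) (letters w))"

lemma deg_weight_add: "deg_weight a b (v + w) = deg_weight a b v + deg_weight a b w"
  by (simp add: deg_weight_def plus_word_def)

lemma deg_weight_count:
  "deg_weight 1 \<i> w = of_nat (count_list (letters w) Gen1) + \<i> * of_nat (count_list (letters w) Gen2)"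
proof -
  have "sum_list (List.map (case_gen 1 \<i>) l)
    = (of_nat (count_list l Gen1) + \<i> * of_nat (count_list l Gen2) :: complex)" for l
  proof (induction l)
    case (Cons g l) then show ?case by (cases g) (auto simp: algebra_simps)
  qed simp
  then show ?thesis by (simp add: deg_weight_def)
qed

lemma count_list_gen_length: "count_list l Gen1 + count_list l Gen2 = length l"
proof (induction l)
  case (Cons g l) then show ?case by (cases g) auto
qed simp

lemma deg_weight_eq_gen:
  shows "deg_weight 1 \<i> w = 1 \<longleftrightarrow> w = Word [Gen1]"
    and "deg_weight 1 \<i> w = \<i> \<longleftrightarrow> w = Word [Gen2]"
    and "deg_weight 1 \<i> w = 0 \<longleftrightarrow> w = 0"
proof -
  have c: "deg_weight 1 \<i> w = Complex a b \<longleftrightarrow>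
      real (count_list (letters w) Gen1) = a \<and> real (count_list (letters w) Gen2) = b" for a b
    by (auto simp: deg_weight_count complex_eq_iff)
  obtain l where w: "w = Word l" by (cases w)
  have 1: "count_list l Gen1 = 1 \<and> count_list l Gen2 = 0 \<longleftrightarrow> l = [Gen1]"
    using count_list_gen_length[of l]
    by (cases l; cases "tl l"; cases "hd l") auto
  have 2: "count_list l Gen1 = 0 \<and> count_list l Gen2 = 1 \<longleftrightarrow> l = [Gen2]"
    using count_list_gen_length[of l]
    by (cases l; cases "tl l"; cases "hd l") auto
  have 0: "count_list l Gen1 = 0 \<and> count_list l Gen2 = 0 \<longleftrightarrow> l = []"
    using count_list_gen_length[of l] by auto
  have "(1 :: complex) = Complex 1 0" "\<i> = Complex 0 1" "0 = Complex 0 0"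
    by (simp_all add: complex_eq_iff)
  then show "deg_weight 1 \<i> w = 1 \<longleftrightarrow> w = Word [Gen1]"
    "deg_weight 1 \<i> w = \<i> \<longleftrightarrow> w = Word [Gen2]"
    "deg_weight 1 \<i> w = 0 \<longleftrightarrow> w = 0"
    using 0 1 2 c[of 1 0] c[of 0 1] c[of 0 0] by (simp_all add: w zero_word_def)
qed

definition degree_der :: "complex \<Rightarrow> complex \<Rightarrow> free_alg \<Rightarrow> free_alg" where
  "degree_der a b = weight_der (deg_weight a b)"

lemmas degree_der_add = weight_der_add[of "deg_weight a b" for a b, folded degree_der_def]
  and degree_der_diff = weight_der_diff[of "deg_weight a b" for a b, folded degree_der_def]
  and degree_der_scale = weight_der_scale[of "deg_weight a b" for a b, folded degree_der_def]
  and degree_der_mult = weight_der_mult[of "deg_weight a b" for a b, OF deg_weight_add, folded degree_der_def]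

lemma degree_der_e1: "degree_der a b e1 = scale a e1" and degree_der_e2: "degree_der a b e2 = scale b e2"
  by (simp_all add: degree_der_def e1_def e2_def weight_der_single scale_single deg_weight_def)

definition homog :: "complex \<Rightarrow> complex \<Rightarrow> complex \<Rightarrow> free_alg \<Rightarrow> bool" where
  "homog a b d p \<longleftrightarrow> degree_der a b p = scale d p"

lemma homog_e1: "homog a b a e1" and homog_e2: "homog a b b e2"
  by (simp_all add: homog_def degree_der_e1 degree_der_e2)

lemma homog_mult: "homog a b d p \<Longrightarrow> homog a b d' q \<Longrightarrow> homog a b (d + d') (p * q)"
  by (simp add: homog_def degree_der_mult scale_mult_left scale_mult_right scale_add_left)

lemma homog_add: "homog a b d p \<Longrightarrow> homog a b d q \<Longrightarrow> homog a b d (p + q)"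
  by (simp add: homog_def degree_der_add scale_add_right)

lemma homog_diff: "homog a b d p \<Longrightarrow> homog a b d q \<Longrightarrow> homog a b d (p - q)"
  by (simp add: homog_def degree_der_diff scale_diff_right)

lemma homog_scale: "homog a b d p \<Longrightarrow> homog a b d (scale c p)"
  by (simp add: homog_def degree_der_scale mult.commute)

lemma homog_one: "homog a b 0 1"
  by (simp add: homog_def degree_der_def deg_weight_def zero_word_def weight_der_single flip: single_one)

lemma homog_eq: "homog a b d p \<Longrightarrow> d = d' \<Longrightarrow> homog a b d' p" by simp

lemma homog_power: "homog a b d p \<Longrightarrow> homog a b (of_nat n * d) (p ^ n)"
proof (induction n)
  case 0 then show ?case by (simp add: homog_one)
next
  case (Suc n)
  then have "homog a b (d + of_nat n * d) (p * p ^ n)" by (intro homog_mult) auto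
  then show ?case by (simp add: algebra_simps)
qed

lemma homog_serre:
  "homog a b (a + 2 * b) (serre21 r s)" "homog a b (4 * a + b) (serre12 r s)"
proof -
  note h = homog_mult homog_power homog_e1 homog_e2
  show "homog a b (a + 2 * b) (serre21 r s)"
    unfolding serre21_def
    by (intro homog_add homog_diff homog_scale; rule homog_eq, (rule h)+, simp)
  show "homog a b (4 * a + b) (serre12 r s)"
    unfolding serre12_def
    by (intro homog_add homog_diff homog_scale; rule homog_eq, (rule h)+, simp)
qed

lemma degree_der_rel: "x \<in> rel_ideal r s \<Longrightarrow> degree_der a b x \<in> rel_ideal r s"
proof -
  let ?J = "{x \<in> rel_ideal r s. degree_der a b x \<in> rel_ideal r s}"
  have "ideal ?J free_algebra"
  proof (rule ideal_free_algebraI)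
    show "0 \<in> ?J" by (simp add: degree_der_def)
    show "- x \<in> ?J" if "x \<in> ?J" for x using that by (simp add: degree_der_def weight_der_minus rel_minus)
  qed (auto simp: degree_der_add degree_der_mult intro: rel_add rel_mult_left rel_mult_right)
  moreover have "serre21 r s \<in> ?J" "serre12 r s \<in> ?J"
    using homog_serre[of a b r s] serre_in_rel[of r s] by (auto simp: homog_def intro: rel_scale)
  ultimately have "rel_ideal r s \<subseteq> ?J" by (rule rel_ideal_least)
  then show "x \<in> rel_ideal r s \<Longrightarrow> degree_der a b x \<in> rel_ideal r s" by auto
qed

section \<open>Representation in a quantum torus\<close>

text \<open>Exponents of Laurent monomials in \<open>T\<^sub>1, \<dots>, T\<^sub>6\<close>.\<close>

type_synonym expo = "int \<times> int \<times> int \<times> int \<times> int \<times> int"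

text \<open>Quantified exponents should not be split into their six components.\<close>

declare split_paired_All [simp del] split_paired_Ex [simp del]

text \<open>The exponents of \<open>r\<close> and \<open>s\<close> in the factor \<open>c\<close> of \<open>T\<^sup>a T\<^sup>b = c T\<^bsup>a + b\<^esup>\<close>, where \<open>T\<^sup>a\<close> stands
  for the ordered monomial. They come from moving every \<open>T\<^sub>i\<close> in \<open>T\<^sup>a\<close> past the \<open>T\<^sub>j\<close> with \<open>j < i\<close>
  in \<open>T\<^sup>b\<close> by means of \<open>T\<^sub>j T\<^sub>i = q T\<^sub>i T\<^sub>j\<close>. Here \<open>q\<close> is read off from the straightening relation of
  \<open>X\<^sub>j\<close> and \<open>X\<^sub>i\<close>; for example \<open>q = s\<^sup>3\<close> for \<open>j = 1\<close> and \<open>i = 6\<close>.\<close>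

fun rexp :: "expo \<Rightarrow> expo \<Rightarrow> int" where
  "rexp (a1, a2, a3, a4, a5, a6) (b1, b2, b3, b4, b5, b6) =
     - (3*a2*b1 + 2*a3*b1 + 3*a4*b1 + a5*b1 + 3*a3*b2 + 6*a4*b2 + 3*a5*b2 + 3*a6*b2
        + 3*a4*b3 + 2*a5*b3 + 3*a6*b3 + 3*a5*b4 + 6*a6*b4 + 3*a6*b5)"

fun sexp :: "expo \<Rightarrow> expo \<Rightarrow> int" where
  "sexp (a1, a2, a3, a4, a5, a6) (b1, b2, b3, b4, b5, b6) =
     - (a3*b1 + 3*a4*b1 + 2*a5*b1 + 3*a6*b1 + 3*a4*b2 + 3*a5*b2 + 6*a6*b2
        + a5*b3 + 3*a6*b3 + 3*a6*b4)"

lemma rexp_add: "rexp (a + b) c = rexp a c + rexp b c" "rexp a (b + c) = rexp a b + rexp a c"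
  by (cases a; cases b; cases c; simp add: algebra_simps)+

lemma sexp_add: "sexp (a + b) c = sexp a c + sexp b c" "sexp a (b + c) = sexp a b + sexp a c"
  by (cases a; cases b; cases c; simp add: algebra_simps)+

text \<open>The filtration weight. The weights are chosen so that in each of the fifteen straightening
  relations \<open>X\<^sub>i X\<^sub>j = q X\<^sub>j X\<^sub>i + \<dots>\<close> the remaining terms have smaller weight, and so that in the quantum
  torus the image of \<open>X\<^sub>i\<close> has \<open>T\<^sub>i\<close> as its only term of maximal weight.\<close>

fun wgt :: "expo \<Rightarrow> int" where
  "wgt (a1, a2, a3, a4, a5, a6) = 3*a1 + 3*a2 + a3 + a4 + a5 + 3*a6"

lemma wgt_add [simp]: "wgt (a + b) = wgt a + wgt b"
  by (cases a; cases b) simp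

lemma wgt_zero [simp]: "wgt 0 = 0" by (simp add: zero_prod_def)

lemma wgt_diff [simp]: "wgt (a - b) = wgt a - wgt b"
  by (cases a; cases b) simp

text \<open>The \<open>\<nat>\<^sup>2\<close>-degree of the roots, with the second component as imaginary part. Among the
  exponents in \<open>\<nat>\<^sup>6\<close> only \<open>0\<close> has degree \<open>0\<close>.\<close>

fun dgr :: "expo \<Rightarrow> complex" where
  "dgr (a1, a2, a3, a4, a5, a6) =
     of_int (a1 + 3*a2 + 2*a3 + 3*a4 + a5) + \<i> * of_int (a2 + a3 + 2*a4 + a5 + a6)"

lemma dgr_add [simp]: "dgr (a + b) = dgr a + dgr b"
  by (cases a; cases b) (simp add: algebra_simps)

lemma dgr_zero [simp]: "dgr 0 = 0" by (simp add: zero_prod_def)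

lemma dgr_diff [simp]: "dgr (a - b) = dgr a - dgr b"
  by (cases a; cases b) (simp add: algebra_simps)

text \<open>The letters stand for the six root vectors.\<close>

datatype letter = A1 | A2 | A3 | A4 | A5 | A6

primrec unit_exp :: "letter \<Rightarrow> expo" where
  "unit_exp A1 = (1,0,0,0,0,0)" | "unit_exp A2 = (0,1,0,0,0,0)" | "unit_exp A3 = (0,0,1,0,0,0)"
| "unit_exp A4 = (0,0,0,1,0,0)" | "unit_exp A5 = (0,0,0,0,1,0)" | "unit_exp A6 = (0,0,0,0,0,1)"

abbreviation letter_wgt :: "letter \<Rightarrow> int" where "letter_wgt i \<equiv> wgt (unit_exp i)"

lemma letter_wgt_pos: "letter_wgt i > 0" by (cases i) auto

definition content :: "letter list \<Rightarrow> expo" where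
  "content u = sum_list (List.map unit_exp u)"

lemma content_simps [simp]: "content [] = 0" "content (i # u) = unit_exp i + content u"
  "content (u @ v) = content u + content v"
  by (simp_all add: content_def)

primrec coord :: "letter \<Rightarrow> expo \<Rightarrow> int" where
  "coord A1 a = fst a" | "coord A2 a = fst (snd a)" | "coord A3 a = fst (snd (snd a))"
| "coord A4 a = fst (snd (snd (snd a)))" | "coord A5 a = fst (snd (snd (snd (snd a))))"
| "coord A6 a = snd (snd (snd (snd (snd a))))"

lemma coord_add [simp]: "coord i (a + b) = coord i a + coord i b"
  and coord_zero [simp]: "coord i 0 = 0"
  by (cases i; simp)+

lemma coord_unit_exp: "coord i (unit_exp j) = (if i = j then 1 else 0)"
  by (cases i; cases j) auto

lemma coord_content: "coord i (content u) = int (count_list u i)"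
  by (induction u) (auto simp: coord_unit_exp)

lemma expo_eqI: "(\<And>i. coord i a = coord i b) \<Longrightarrow> a = b"
  using coord.simps by (cases a; cases b) (metis fst_conv snd_conv)

definition nonneg :: "expo \<Rightarrow> bool" where
  "nonneg a \<longleftrightarrow> (\<forall>i. 0 \<le> coord i a)"

lemma nonneg_content: "nonneg (content u)"
  by (simp add: nonneg_def coord_content)

lemma nonneg_imp_content:
  assumes "nonneg a" shows "\<exists>u. content u = a"
proof -
  have rep: "coord i (content (replicate n j)) = (if i = j then int n else 0)" for i j n
    by (induction n) (auto simp: coord_unit_exp)
  let ?n = "\<lambda>i. nat (coord i a)"
  have "content (concat (List.map (\<lambda>i. replicate (?n i) i) [A1, A2, A3, A4, A5, A6])) = a"
    using assms by (intro expo_eqI, case_tac i) (simp_all add: rep nonneg_def del: coord.simps)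
  then show ?thesis by blast
qed

lemma dgr_nonneg_eq_0: "nonneg a \<Longrightarrow> dgr a = 0 \<Longrightarrow> a = 0"
proof -
  assume a: "nonneg a" "dgr a = 0"
  obtain a1 a2 a3 a4 a5 a6 where eq: "a = (a1, a2, a3, a4, a5, a6)" by (cases a)
  have "0 \<le> a1" "0 \<le> a2" "0 \<le> a3" "0 \<le> a4" "0 \<le> a5" "0 \<le> a6"
    using a(1) unfolding nonneg_def eq
    by (metis coord.simps fst_conv snd_conv)+
  moreover have "real_of_int (a1 + 3*a2 + 2*a3 + 3*a4 + a5) = 0" "real_of_int (a2 + a3 + 2*a4 + a5 + a6) = 0"
    using a(2) by (simp_all add: eq complex_eq_iff)
  then have "a1 + 3*a2 + 2*a3 + 3*a4 + a5 = 0" "a2 + a3 + 2*a4 + a5 + a6 = 0"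
    by (simp_all only: of_int_eq_0_iff)
  ultimately show ?thesis by (simp add: eq zero_prod_def)
qed

definition level :: "int \<Rightarrow> expo set" where
  "level n = {a. nonneg a \<and> wgt a = n}"

lemma finite_level: "finite (level n)"
proof (rule finite_subset)
  let ?I = "{0..n}"
  show "level n \<subseteq> ?I \<times> ?I \<times> ?I \<times> ?I \<times> ?I \<times> ?I"
  proof
    fix a assume a: "a \<in> level n"
    then have *: "0 \<le> coord A1 a" "0 \<le> coord A2 a" "0 \<le> coord A3 a" "0 \<le> coord A4 a"
      "0 \<le> coord A5 a" "0 \<le> coord A6 a" "wgt a = n"
      by (auto simp: level_def nonneg_def simp del: coord.simps)
    then show "a \<in> ?I \<times> ?I \<times> ?I \<times> ?I \<times> ?I \<times> ?I" by (cases a) auto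
  qed
qed auto

locale generic_parameters =
  fixes r s :: complex
  assumes r0 [simp]: "r \<noteq> 0" and s0 [simp]: "s \<noteq> 0"
    and generic: "\<And>m n :: int. r powi m * s powi n = 1 \<Longrightarrow> m = 0 \<and> n = 0"
begin

definition mon :: "int \<Rightarrow> int \<Rightarrow> complex" where
  "mon k l = r powi k * s powi l"

lemma mon_mult: "mon k l * mon k' l' = mon (k + k') (l + l')"
  by (simp add: mon_def power_int_add)

lemma mon_mult_left: "mon k l * (mon k' l' * x) = mon (k + k') (l + l') * x"
  by (simp add: mon_mult flip: mult.assoc)

lemma mon_zero: "mon 0 0 = 1"
  by (simp add: mon_def)

lemma mon_eq_1_iff: "mon k l = 1 \<longleftrightarrow> k = 0 \<and> l = 0"
  using generic[of k l] by (auto simp: mon_def)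

lemma mon_nz [simp]: "mon k l \<noteq> 0"
  by (simp add: mon_def)

definition twist :: "expo \<Rightarrow> expo \<Rightarrow> complex" where
  "twist a b = mon (rexp a b) (sexp a b)"

lemma twist_add: "twist (a + b) c = twist a c * twist b c" "twist a (b + c) = twist a b * twist a c"
  by (simp_all add: twist_def rexp_add sexp_add mon_mult)

lemma twist_nz [simp]: "twist a b \<noteq> 0"
  by (simp add: twist_def)

lemma twist_zero [simp]: "twist 0 b = 1" "twist a 0 = 1"
  using twist_add(1)[of 0 0 b] twist_add(2)[of a 0 0] by auto

text \<open>The action of \<open>T\<^sup>a\<close> on functions on \<open>\<int>\<^sup>6\<close>, that is, on formal combinations of Laurent monomials:
  multiplication by \<open>T\<^sup>a\<close> from the left.\<close>

definition torus_mon :: "expo \<Rightarrow> (expo \<Rightarrow> complex) \<Rightarrow> expo \<Rightarrow> complex" where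
  "torus_mon a f = (\<lambda>m. twist a (m - a) * f (m - a))"

lemma torus_mon_mult: "torus_mon a (torus_mon b f) m = twist a b * torus_mon (a + b) f m"
proof -
  have "twist a (m - a) = twist a (m - a - b) * twist a b" using twist_add(2)[of a "m - a - b" b] by simp
  then show ?thesis by (simp add: torus_mon_def twist_add algebra_simps diff_diff_eq)
qed

text \<open>A list of coefficients and exponents represents an element of the quantum torus. Explicit
  lists make the products below accessible to rewriting.\<close>

definition torus_op :: "(complex \<times> expo) list \<Rightarrow> (expo \<Rightarrow> complex) \<Rightarrow> expo \<Rightarrow> complex" where
  "torus_op L f = (\<lambda>m. \<Sum>(c, a)\<leftarrow>L. c * torus_mon a f m)"

definition torus_mult ::
  "(complex \<times> expo) list \<Rightarrow> (complex \<times> expo) list \<Rightarrow> (complex \<times> expo) list" where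
  "torus_mult L K = concat (List.map (\<lambda>(c, a). List.map (\<lambda>(d, b). (c * d * twist a b, a + b)) K) L)"

text \<open>The product \<open>x y - r\<^sup>k s\<^sup>l y x\<close>. The scalar is merged into the exponents of the twist, so that
  the coefficients remain products of single monomials in \<open>r\<close> and \<open>s\<close>.\<close>

definition torus_skew ::
  "int \<Rightarrow> int \<Rightarrow> (complex \<times> expo) list \<Rightarrow> (complex \<times> expo) list
    \<Rightarrow> (complex \<times> expo) list" where
  "torus_skew k l L K = torus_mult L K @ concat (List.map (\<lambda>(c, a). List.map (\<lambda>(d, b).
     (- (c * d * mon (k + rexp a b) (l + sexp a b)), a + b)) L) K)"

lemma torus_op_append: "torus_op (L @ K) f m = torus_op L f m + torus_op K f m"
  by (simp add: torus_op_def)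

lemma torus_op_scale: "torus_op (List.map (\<lambda>(c, a). (q * c, a)) L) f m = q * torus_op L f m"
  by (induction L) (auto simp: torus_op_def algebra_simps)

lemma torus_op_mult: "torus_op (torus_mult L K) f m = torus_op L (torus_op K f) m"
proof (induction L)
  case (Cons x L)
  obtain c a where x: "x = (c, a)" by (cases x)
  have "torus_op (List.map (\<lambda>(d, b). (c * d * twist a b, a + b)) K) f m = c * torus_mon a (torus_op K f) m"
  proof (induction K)
    case (Cons y K)
    obtain d b where y: "y = (d, b)" by (cases y)
    have "torus_mon a (torus_op ((d, b) # K) f) m
        = d * torus_mon a (torus_mon b f) m + torus_mon a (torus_op K f) m"
      by (simp add: torus_mon_def torus_op_def algebra_simps)
    with Cons show ?case
      by (simp add: y torus_mon_mult torus_op_def algebra_simps)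
  qed (simp add: torus_op_def torus_mon_def)
  with Cons show ?case
    by (simp add: torus_mult_def x torus_op_append) (simp add: torus_op_def)
qed (simp add: torus_op_def torus_mult_def)

lemma torus_skew: "torus_op (torus_skew k l L K) f m = torus_op L (torus_op K f) m - mon k l * torus_op K (torus_op L f) m"
proof -
  have m: "mon (k + rexp a b) (l + sexp a b) = mon k l * twist a b" for a b
    by (simp add: twist_def mon_mult)
  have "concat (List.map (\<lambda>(c, a). List.map (\<lambda>(d, b).
      (- (c * d * mon (k + rexp a b) (l + sexp a b)), a + b)) L) K)
    = List.map (\<lambda>(c, a). (- mon k l * c, a)) (torus_mult K L)"
    unfolding m by (induction K) (auto simp: torus_mult_def)
  then show ?thesis
    using torus_op_scale[of "- mon k l"] by (simp add: torus_skew_def torus_op_append torus_op_mult)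
qed

definition torus_coeff :: "(complex \<times> expo) list \<Rightarrow> expo \<Rightarrow> complex" where
  "torus_coeff L a = (\<Sum>(c, b)\<leftarrow>L. if b = a then c else 0)"

lemma torus_op_eq_sum_coeff:
  assumes "finite A" "snd ` set L \<subseteq> A"
  shows "torus_op L f m = (\<Sum>a\<in>A. torus_coeff L a * torus_mon a f m)"
  using assms(2)
proof (induction L)
  case (Cons x L)
  obtain c b where x: "x = (c, b)" by (cases x)
  have c: "torus_coeff (x # L) a = (if b = a then c else 0) + torus_coeff L a" for a
    by (simp add: x torus_coeff_def)
  have "(\<Sum>a\<in>A. torus_coeff (x # L) a * torus_mon a f m)
      = (\<Sum>a\<in>A. (if b = a then c * torus_mon a f m else 0) + torus_coeff L a * torus_mon a f m)"
    unfolding c by (rule sum.cong[OF refl]) (simp add: distrib_right)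
  also have "\<dots> = (\<Sum>a\<in>A. (if b = a then c * torus_mon a f m else 0)) + torus_op L f m"
    using Cons by (simp add: sum.distrib)
  also have "(\<Sum>a\<in>A. (if b = a then c * torus_mon a f m else 0)) = c * torus_mon b f m"
    using assms(1) Cons(2) by (simp add: x)
  finally show ?case by (simp add: x torus_op_def)
qed (simp add: torus_op_def torus_coeff_def)

lemma torus_op_eqI:
  assumes "\<And>a. a \<in> snd ` set L \<union> snd ` set K \<Longrightarrow> torus_coeff L a = torus_coeff K a"
  shows "torus_op L f = torus_op K f"
proof
  fix m
  let ?A = "snd ` set L \<union> snd ` set K"
  show "torus_op L f m = torus_op K f m"
    using torus_op_eq_sum_coeff[of ?A L f m] torus_op_eq_sum_coeff[of ?A K f m] assms by simp
qed

text \<open>The denominators that occur when straightening relations are solved for their leading terms.\<close>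

lemma generic_nonzero: "r + s \<noteq> 0" "r^2 + s^2 \<noteq> 0" "r^2 - r * s + s^2 \<noteq> 0"
proof -
  have *: "r ^ n \<noteq> s ^ n" if "n > 0" for n :: nat
  proof
    assume "r ^ n = s ^ n"
    then have "r powi int n * s powi (- int n) = 1" by (simp add: power_int_minus)
    with generic[of "int n" "- int n"] that show False by simp
  qed
  show "r + s \<noteq> 0"
  proof
    assume "r + s = 0" then have "r = - s" by (simp add: eq_neg_iff_add_eq_0)
    with *[of 2] show False by simp
  qed
  show "r^2 + s^2 \<noteq> 0"
  proof
    assume "r^2 + s^2 = 0" then have "r^2 = - (s^2)" by (simp add: eq_neg_iff_add_eq_0)
    then have "(r^2)^2 = (s^2)^2" by simp
    with *[of 4] show False by simp
  qed
  show "r^2 - r * s + s^2 \<noteq> 0"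
  proof
    assume "r^2 - r * s + s^2 = 0"
    then have "(r + s) * (r^2 - r * s + s^2) = 0" by simp
    then have "r^3 = - (s^3)" by (simp add: algebra_simps power2_eq_square power3_eq_cube eq_neg_iff_add_eq_0)
    then have "(r^3)^2 = (s^3)^2" by simp
    with *[of 6] show False by simp
  qed
qed

text \<open>The image of \<open>e\<^sub>1\<close>; its terms \<open>T\<^sub>1\<close>, \<open>T\<^sub>2 T\<^sub>3\<^sup>-\<^sup>1\<close>, \<open>T\<^sub>3\<^sup>2 T\<^sub>4\<^sup>-\<^sup>1\<close>, \<open>T\<^sub>3 T\<^sub>5\<^sup>-\<^sup>1\<close>, \<open>T\<^sub>4 T\<^sub>5\<^sup>-\<^sup>2\<close> and
  \<open>T\<^sub>5 T\<^sub>6\<^sup>-\<^sup>1\<close> all have degree \<open>(1, 0)\<close>. The last one turns \<open>T\<^sub>6\<close> into a multiple of \<open>T\<^sub>5\<close>, and \<open>T\<^sub>3 T\<^sub>5\<^sup>-\<^sup>1\<close>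
  and \<open>T\<^sub>2 T\<^sub>3\<^sup>-\<^sup>1\<close> continue the chain of skew commutators to \<open>T\<^sub>3\<close> and \<open>T\<^sub>2\<close>, while \<open>T\<^sub>4 T\<^sub>5\<^sup>-\<^sup>2\<close> leads to
  \<open>T\<^sub>4\<close>. Rescaling the \<open>T\<^sub>i\<close> normalises all coefficients but one, for instance that of
  \<open>T\<^sub>3\<^sup>2 T\<^sub>4\<^sup>-\<^sup>1\<close>; this one is dictated by the quartic Serre relation, and the choice \<open>r + s\<close> at
  \<open>T\<^sub>3 T\<^sub>5\<^sup>-\<^sup>1\<close> clears its denominator.\<close>

definition torus_e1 :: "(complex \<times> expo) list" where
  "torus_e1 = [(1, (1,0,0,0,0,0)),
     (1, (0,1,-1,0,0,0)),
     (mon 5 0, (0,0,2,-1,0,0)),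
     (mon 1 0 + mon 0 1, (0,0,1,0,-1,0)),
     (1, (0,0,0,1,-2,0)),
     (1, (0,0,0,0,1,-1))]"

definition torus_e2 :: "(complex \<times> expo) list" where
  "torus_e2 = [(1, (0,0,0,0,0,1))]"

definition lead5 :: complex where "lead5 = 1 - mon (-3) 3"

definition lead3 :: complex where "lead3 = lead5 * (1 - mon (-2) 2)"

definition lead2 :: complex where "lead2 = lead3 * (1 - mon (-1) 1)"

definition torus_x5 :: "(complex \<times> expo) list" where
  "torus_x5 = [(lead5, (0,0,0,0,1,0))]"

definition torus_x3 :: "(complex \<times> expo) list" where
  "torus_x3 = [(lead3 * mon 1 0, (0,0,1,0,0,0)), (lead3, (0,0,0,1,-1,0)), (lead3 * mon 3 0, (0,0,0,0,2,-1))]"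

definition torus_x4 :: "(complex \<times> expo) list" where
  "torus_x4 = [(lead2 * lead5, (0,0,0,1,0,0)), (lead2 * lead5 * mon 6 0, (0,0,0,0,3,-1))]"

definition torus_x2 :: "(complex \<times> expo) list" where
  "torus_x2 = [(lead2 * mon 1 0, (0,1,0,0,0,0)),
     (lead2 * mon 9 0, (0,0,3,-1,0,0)),
     (lead2 * mon 5 0 * (1 + mon (-1) 1 + mon (-2) 2), (0,0,2,0,-1,0)),
     (lead2 * mon 4 0 * (1 + mon (-1) 1 + mon (-2) 2), (0,0,1,1,-2,0)),
     (lead2 * mon 4 0 * (1 + mon (-1) 1 + mon (-2) 2), (0,0,1,0,1,-1)),
     (lead2 * mon 6 0, (0,0,0,2,-3,0)),
     (lead2 * mon 3 0 * (1 + mon (-3) 3), (0,0,0,1,0,-1)),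
     (lead2 * mon 9 0, (0,0,0,0,3,-2))]"

text \<open>Comparing coefficients for an explicit list \<open>A\<close> of exponents avoids case distinctions over
  an unknown exponent.\<close>

lemma torus_op_eq_by_coeff:
  assumes "L = L'" "list_all (\<lambda>(c, a). a \<in> set A) L'" "list_all (\<lambda>(c, a). a \<in> set A) K"
    and "list_all (\<lambda>a. torus_coeff L' a = torus_coeff K a) A"
  shows "torus_op L f = torus_op K f"
  by (rule torus_op_eqI) (use assms in \<open>auto simp: list_all_iff\<close>)

lemmas mon_simps = mon_mult mon_mult_left mon_zero algebra_simps

text \<open>The images of the root vectors, computed from the skew commutators that define them. Most of the
  products cancel: a monomial of \<open>e\<^sub>1\<close> contributes only if the scalar in the skew commutator differs
  from its commutation factor.\<close>

lemma torus_x5_eq: "torus_op (torus_skew 0 3 torus_e1 torus_e2) f = torus_op torus_x5 f"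
  by (rule torus_op_eq_by_coeff[where A =
      "[(1,0,0,0,0,1), (0,1,-1,0,0,1), (0,0,2,-1,0,1), (0,0,1,0,-1,1), (0,0,0,1,-2,1),
      (0,0,0,0,1,0)]"],
      simp add: torus_skew_def torus_mult_def twist_def torus_e1_def torus_e2_def,
      simp, simp add: torus_x5_def,
      simp add: torus_x5_def torus_coeff_def lead5_def mon_simps)

lemma torus_x3_eq: "torus_op (torus_skew 1 2 torus_e1 torus_x5) f = torus_op torus_x3 f"
  by (rule torus_op_eq_by_coeff[where A =
      "[(1,0,0,0,1,0), (0,1,-1,0,1,0), (0,0,2,-1,1,0), (0,0,1,0,0,0), (0,0,0,1,-1,0),
      (0,0,0,0,2,-1)]"],
      simp add: torus_skew_def torus_mult_def twist_def torus_e1_def torus_x5_def,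
      simp, simp add: torus_x3_def,
      simp add: torus_x3_def torus_coeff_def lead3_def mon_simps)

lemma torus_x4_eq: "torus_op (torus_skew 2 1 torus_x3 torus_x5) f = torus_op torus_x4 f"
  by (rule torus_op_eq_by_coeff[where A = "[(0,0,1,0,1,0),(0,0,0,1,0,0),(0,0,0,0,3,-1)]"],
      simp add: torus_skew_def torus_mult_def twist_def torus_x3_def torus_x5_def,
      simp, simp add: torus_x4_def,
      simp add: torus_x4_def torus_coeff_def lead2_def mon_simps)

lemma torus_x2_eq: "torus_op (torus_skew 2 1 torus_e1 torus_x3) f = torus_op torus_x2 f"
  by (rule torus_op_eq_by_coeff[where A =
      "[(1,0,1,0,0,0), (1,0,0,1,-1,0), (1,0,0,0,2,-1), (0,1,0,0,0,0), (0,1,-1,1,-1,0),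
      (0,1,-1,0,2,-1), (0,0,3,-1,0,0), (0,0,2,0,-1,0), (0,0,2,-1,2,-1), (0,0,1,1,-2,0),
      (0,0,1,0,1,-1), (0,0,0,2,-3,0), (0,0,0,1,0,-1), (0,0,0,0,3,-2)]"],
      simp add: torus_skew_def torus_mult_def twist_def torus_e1_def torus_x3_def,
      simp, simp add: torus_x2_def,
      simp add: torus_x2_def torus_coeff_def lead2_def mon_simps)

lemma torus_serre12: "torus_op (torus_skew 3 0 torus_e1 torus_x2) f = torus_op [] f"
  apply (rule torus_op_eq_by_coeff[where A =
      "[(1,1,0,0,0,0), (1,0,3,-1,0,0), (1,0,2,0,-1,0), (1,0,1,1,-2,0), (1,0,1,0,1,-1),
      (1,0,0,2,-3,0), (1,0,0,1,0,-1), (1,0,0,0,3,-2), (0,2,-1,0,0,0), (0,1,2,-1,0,0),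
      (0,1,1,0,-1,0), (0,1,0,1,-2,0), (0,1,0,0,1,-1), (0,1,-1,2,-3,0), (0,1,-1,1,0,-1),
      (0,1,-1,0,3,-2), (0,0,5,-2,0,0), (0,0,4,-1,-1,0), (0,0,3,0,-2,0), (0,0,3,-1,1,-1),
      (0,0,2,1,-3,0), (0,0,2,0,0,-1), (0,0,2,-1,3,-2), (0,0,1,2,-4,0), (0,0,1,1,-1,-1),
      (0,0,1,0,2,-2), (0,0,0,3,-5,0), (0,0,0,2,-2,-1), (0,0,0,1,1,-2), (0,0,0,0,4,-3)]"],
      simp add: torus_skew_def torus_mult_def twist_def torus_e1_def torus_x2_def,
      simp, simp, simp only: list.pred_inject simp_thms)
  apply (intro conjI)
  apply (simp_all only: torus_coeff_def list.map sum_list.Nil sum_list.Cons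
      prod.case prod.inject if_False if_True simp_thms rel_simps add_0_left add_0_right eq_numeral_simps)
  apply (simp_all only: distrib_left distrib_right minus_add_distrib mult_ac mon_mult
      mon_mult_left mult_1_left mult_1_right arith_simps
      one_plus_numeral numeral_plus_one one_add_one add_neg_numeral_special mon_zero)
  apply simp_all
  done

lemma torus_serre21: "torus_op (torus_skew 3 0 torus_x5 torus_e2) f = torus_op [] f"
  by (rule torus_op_eq_by_coeff[where A = "[(0,0,0,0,1,1)]"],
      simp add: torus_skew_def torus_mult_def twist_def torus_x5_def torus_e2_def,
      simp, simp,
      simp add: torus_coeff_def mon_simps)

primrec gen_op :: "gen \<Rightarrow> (expo \<Rightarrow> complex) \<Rightarrow> expo \<Rightarrow> complex" where
  "gen_op Gen1 = torus_op torus_e1"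
| "gen_op Gen2 = torus_op torus_e2"

primrec word_op :: "gen list \<Rightarrow> (expo \<Rightarrow> complex) \<Rightarrow> expo \<Rightarrow> complex" where
  "word_op [] f = f"
| "word_op (g # gs) f = gen_op g (word_op gs f)"

definition rep :: "free_alg \<Rightarrow> (expo \<Rightarrow> complex) \<Rightarrow> expo \<Rightarrow> complex" where
  "rep p f m = (\<Sum>w\<in>Poly_Mapping.keys p. Poly_Mapping.lookup p w * word_op (letters w) f m)"

lemma torus_op_linear: "torus_op L (\<lambda>m. c * f m + g m) m = c * torus_op L f m + torus_op L g m"
  by (induction L) (auto simp: torus_op_def torus_mon_def algebra_simps)

lemma gen_op_linear: "gen_op g (\<lambda>m. c * f m + h m) m = c * gen_op g f m + gen_op g h m"
  by (cases g) (simp_all add: torus_op_linear)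

lemma word_op_append: "word_op (v @ w) f = word_op v (word_op w f)"
  by (induction v) auto

lemma word_op_linear: "word_op w (\<lambda>m. c * f m + h m) m = c * word_op w f m + word_op w h m"
proof (induction w arbitrary: m)
  case (Cons g w)
  have "word_op w (\<lambda>m. c * f m + h m) = (\<lambda>m. c * word_op w f m + word_op w h m)"
    using Cons by (intro ext)
  then show ?case by (simp add: gen_op_linear)
qed simp

lemma word_op_zero: "word_op w (\<lambda>m. 0) m = 0"
  using word_op_linear[of w "-1" "\<lambda>m. 0" "\<lambda>m. 0" m] by simp

lemma rep_superset:
  assumes "finite S" "Poly_Mapping.keys p \<subseteq> S"
  shows "rep p f m = (\<Sum>w\<in>S. Poly_Mapping.lookup p w * word_op (letters w) f m)"
  unfolding rep_def using assms
  by (intro sum.mono_neutral_left) (auto simp: in_keys_iff)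

lemma rep_add: "rep (p + q) f m = rep p f m + rep q f m"
proof -
  let ?S = "Poly_Mapping.keys p \<union> Poly_Mapping.keys q"
  have "Poly_Mapping.keys (p + q) \<subseteq> ?S" by (rule Poly_Mapping.keys_add)
  then show ?thesis
    using rep_superset[of ?S p f m] rep_superset[of ?S q f m] rep_superset[of ?S "p + q" f m]
    by (simp add: lookup_add algebra_simps sum.distrib)
qed

lemma rep_single: "rep (Poly_Mapping.single w c) f m = c * word_op (letters w) f m"
  using rep_superset[of "{w}" "Poly_Mapping.single w c" f m] by simp

lemma rep_zero: "rep 0 f m = 0" by (simp add: rep_def)

lemma rep_scale: "rep (scale c p) f m = c * rep p f m"
  by (induction p rule: free_alg_induct)
    (simp_all add: rep_zero rep_add scale_add_right scale_single rep_single algebra_simps)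

lemma rep_minus: "rep (- p) f m = - rep p f m"
  using rep_scale[of "-1" p f m] by (simp add: scale_minus_left)

lemma rep_diff: "rep (p - q) f m = rep p f m - rep q f m"
  using rep_add[of p "- q" f m] by (simp add: rep_minus)

lemma rep_sum: "rep (\<Sum>a\<in>A. F a) f m = (\<Sum>a\<in>A. rep (F a) f m)"
  by (induction A rule: infinite_finite_induct) (simp_all add: rep_zero rep_add)

lemma rep_mult: "rep (p * q) f m = rep p (rep q f) m"
proof (induction p rule: free_alg_induct)
  case (add v c p)
  have "rep (Poly_Mapping.single v c * q) f m = c * word_op (letters v) (rep q f) m"
  proof (induction q rule: free_alg_induct)
    case zero
    have "rep 0 f = (\<lambda>m. 0)" by (rule ext) (rule rep_zero)
    then show ?case by (simp add: rep_zero word_op_zero)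
  next
    case (add w d q)
    have "rep (Poly_Mapping.single w d + q) f = (\<lambda>m. d * word_op (letters w) f m + rep q f m)"
      by (rule ext) (simp add: rep_add rep_single)
    with add show ?case
      by (simp add: distrib_left mult_single rep_add rep_single plus_word_def word_op_append
          word_op_linear)
  qed
  with add show ?case by (simp add: distrib_right rep_add rep_single)
qed (simp add: rep_zero)

lemma rep_e1: "rep e1 f = torus_op torus_e1 f" and rep_e2: "rep e2 f = torus_op torus_e2 f"
  by (rule ext; simp add: e1_def e2_def rep_single)+

definition x5 :: free_alg where "x5 = e1 * e2 - scale (s^3) (e2 * e1)"

definition x3 :: free_alg where "x3 = e1 * x5 - scale (r * s^2) (x5 * e1)"

definition x2 :: free_alg where "x2 = e1 * x3 - scale (r^2 * s) (x3 * e1)"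

definition x4 :: free_alg where "x4 = x3 * x5 - scale (r^2 * s) (x5 * x3)"

lemma mon_numerals: "s^3 = mon 0 3" "r * s^2 = mon 1 2" "r^2 * s = mon 2 1" "r^3 = mon 3 0"
  by (simp_all add: mon_def power_int_numeral)

lemma rep_skew:
  assumes "\<And>f. rep p f = torus_op L f" "\<And>f. rep q f = torus_op K f"
  shows "rep (p * q - scale (mon k l) (q * p)) f = torus_op (torus_skew k l L K) f"
  by (rule ext) (simp add: rep_diff rep_scale rep_mult assms torus_skew)

lemma rep_x5: "rep x5 f = torus_op torus_x5 f"
  unfolding x5_def mon_numerals rep_skew[OF rep_e1 rep_e2] by (rule torus_x5_eq)

lemma rep_x3: "rep x3 f = torus_op torus_x3 f"
  unfolding x3_def mon_numerals rep_skew[OF rep_e1 rep_x5] by (rule torus_x3_eq)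

lemma rep_x2: "rep x2 f = torus_op torus_x2 f"
  unfolding x2_def mon_numerals rep_skew[OF rep_e1 rep_x3] by (rule torus_x2_eq)

lemma rep_x4: "rep x4 f = torus_op torus_x4 f"
  unfolding x4_def mon_numerals rep_skew[OF rep_x3 rep_x5] by (rule torus_x4_eq)

text \<open>The Serre relations say that \<open>e\<^sub>1\<close> and \<open>x2\<close>, respectively \<open>x5\<close> and \<open>e\<^sub>2\<close>, commute up to \<open>r\<^sup>3\<close>.
  In this form they are checked in the representation and used for straightening.\<close>

lemma serre12_skew: "serre12 r s = e1 * x2 - scale (r^3) (x2 * e1)"
  unfolding serre12_def x2_def x3_def x5_def
  by (simp add: algebra_simps scale_mult_left scale_mult_right scale_diff_right scale_add_right
      scale_diff_left scale_add_left power_numeral_reduce,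
      simp add: mult_ac flip: scale_add_left)

lemma serre21_skew: "scale ((r * s)^3) (serre21 r s) = x5 * e2 - scale (r^3) (e2 * x5)"
  unfolding serre21_def x5_def
  by (simp add: algebra_simps scale_mult_left scale_mult_right scale_diff_right scale_add_right
      scale_diff_left scale_add_left power_numeral_reduce power_int_minus power_mult_distrib,
      simp add: field_simps)

text \<open>The representation factors through \<open>U\<^sup>+\<close>.\<close>

lemma rep_rel:
  assumes "p \<in> rel_ideal r s" shows "rep p f m = 0"
proof -
  let ?J = "{p. \<forall>f m. rep p f m = 0}"
  have z: "torus_op [] f m = 0" for f m by (simp add: torus_op_def)
  have "ideal ?J free_algebra"
  proof (rule ideal_free_algebraI)
    fix x p assume "x \<in> ?J"
    then have "rep x f = (\<lambda>m. 0)" for f by auto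
    then show "p * x \<in> ?J" by (simp add: rep_mult) (simp add: rep_def word_op_zero)
  qed (auto simp: rep_zero rep_add rep_minus rep_mult)
  moreover have "serre12 r s \<in> ?J"
    unfolding serre12_skew mon_numerals
    by (simp add: rep_skew[OF rep_e1 rep_x2] torus_serre12 z)
  moreover have "serre21 r s \<in> ?J"
  proof -
    have "rep (scale ((r * s)^3) (serre21 r s)) f m = 0" for f m
      unfolding serre21_skew mon_numerals
      by (simp add: rep_skew[OF rep_x5 rep_e2] torus_serre21 z)
    then show ?thesis by (simp add: rep_scale)
  qed
  ultimately have "rel_ideal r s \<subseteq> ?J" by (intro rel_ideal_least)
  with assms show ?thesis by auto
qed

section \<open>Leading terms of the root vectors\<close>

definition vac :: "expo \<Rightarrow> complex" where "vac m = (if m = 0 then 1 else 0)"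

text \<open>Applying \<open>p\<close> to the monomial \<open>1\<close> yields its image in the quantum torus, as the family of
  coefficients. These linear forms vanish on the relations and detect leading terms.\<close>

definition symbol :: "free_alg \<Rightarrow> expo \<Rightarrow> complex" where "symbol p = rep p vac"

primrec root_vec :: "letter \<Rightarrow> free_alg" where
  "root_vec A1 = e1" | "root_vec A2 = x2" | "root_vec A3 = x3" | "root_vec A4 = x4" | "root_vec A5 = x5" | "root_vec A6 = e2"

primrec lead_coeff :: "letter \<Rightarrow> complex" where
  "lead_coeff A1 = 1" | "lead_coeff A2 = lead2 * mon 1 0" | "lead_coeff A3 = lead3 * mon 1 0"
| "lead_coeff A4 = lead2 * lead5" | "lead_coeff A5 = lead5" | "lead_coeff A6 = 1"

lemma lead_coeff_nz [simp]: "lead_coeff i \<noteq> 0"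
proof -
  have "lead5 \<noteq> 0" "lead3 \<noteq> 0" "lead2 \<noteq> 0"
    using mon_eq_1_iff[of "-3" 3] mon_eq_1_iff[of "-2" 2] mon_eq_1_iff[of "-1" 1]
    by (auto simp: lead5_def lead3_def lead2_def)
  then show ?thesis by (cases i) auto
qed

definition bounded :: "int \<Rightarrow> (expo \<Rightarrow> complex) \<Rightarrow> bool" where
  "bounded N f \<longleftrightarrow> (\<forall>m. N < wgt m \<longrightarrow> f m = 0)"

text \<open>If \<open>T\<^sup>e\<close> is the only term of maximal weight, then on top coefficients the operator acts like this
  term alone.\<close>

lemma torus_op_lead:
  assumes "bounded N f" "list_all (\<lambda>(d, a). wgt a < wgt e) L"
  shows "bounded (N + wgt e) (torus_op ((c, e) # L) f)"
    and "wgt m = N + wgt e \<Longrightarrow> torus_op ((c, e) # L) f m = c * torus_mon e f m"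
proof -
  have L: "torus_op L f m = 0" if "N + wgt e \<le> wgt m" for m
    using assms(2)
  proof (induction L)
    case (Cons x L)
    obtain d a where x: "x = (d, a)" by (cases x)
    with Cons have "f (m - a) = 0"
      using assms(1) that by (simp add: bounded_def)
    with Cons show ?case by (simp add: x torus_op_def torus_mon_def)
  qed (simp add: torus_op_def)
  have eq: "torus_op ((c, e) # L) f m = c * torus_mon e f m + torus_op L f m" for m
    by (simp add: torus_op_def)
  show "bounded (N + wgt e) (torus_op ((c, e) # L) f)"
    unfolding bounded_def eq using L assms(1)
    by (auto simp: torus_mon_def bounded_def)
  show "wgt m = N + wgt e \<Longrightarrow> torus_op ((c, e) # L) f m = c * torus_mon e f m"
    by (simp add: eq L)
qed

lemma rep_root_vec_lead:
  assumes "bounded N f"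
  shows "bounded (N + letter_wgt i) (rep (root_vec i) f)"
    and "wgt m = N + letter_wgt i \<Longrightarrow>
      rep (root_vec i) f m = lead_coeff i * torus_mon (unit_exp i) f m"
proof -
  define L where "L = tl (case i of A1 \<Rightarrow> torus_e1 | A2 \<Rightarrow> torus_x2 | A3 \<Rightarrow> torus_x3
    | A4 \<Rightarrow> torus_x4 | A5 \<Rightarrow> torus_x5 | A6 \<Rightarrow> torus_e2)"
  have L: "rep (root_vec i) f = torus_op ((lead_coeff i, unit_exp i) # L) f"
    "list_all (\<lambda>(d, a). wgt a < wgt (unit_exp i)) L"
    by (cases i; simp add: L_def rep_e1 rep_e2 rep_x2 rep_x3 rep_x4 rep_x5 torus_e1_def torus_e2_def
        torus_x2_def torus_x3_def torus_x4_def torus_x5_def)+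
  show "bounded (N + letter_wgt i) (rep (root_vec i) f)"
    unfolding L(1) by (rule torus_op_lead(1)[OF assms L(2)])
  show "wgt m = N + letter_wgt i \<Longrightarrow>
      rep (root_vec i) f m = lead_coeff i * torus_mon (unit_exp i) f m"
    unfolding L(1) by (rule torus_op_lead(2)[OF assms L(2)])
qed

definition root_word :: "letter list \<Rightarrow> free_alg" where
  "root_word u = prod_list (List.map root_vec u)"

lemma root_word_simps [simp]: "root_word [] = 1" "root_word (i # u) = root_vec i * root_word u"
  "root_word (u @ v) = root_word u * root_word v"
  by (simp_all add: root_word_def)

text \<open>The leading coefficient of the image of a product of root vectors.\<close>

primrec word_coeff :: "letter list \<Rightarrow> complex" where
  "word_coeff [] = 1"
| "word_coeff (i # u) = lead_coeff i * twist (unit_exp i) (content u) * word_coeff u"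

lemma word_coeff_nz [simp]: "word_coeff u \<noteq> 0"
  by (induction u) auto

lemma word_coeff_append: "word_coeff (u @ v) = word_coeff u * word_coeff v * twist (content u) (content v)"
  by (induction u) (auto simp: twist_add)

lemma symbol_add: "symbol (p + q) m = symbol p m + symbol q m"
  and symbol_diff: "symbol (p - q) m = symbol p m - symbol q m"
  and symbol_scale: "symbol (scale c p) m = c * symbol p m"
  and symbol_sum: "symbol (\<Sum>a\<in>A. F a) m = (\<Sum>a\<in>A. symbol (F a) m)"
  and symbol_rel: "p \<in> rel_ideal r s \<Longrightarrow> symbol p m = 0"
  by (simp_all add: symbol_def rep_add rep_diff rep_scale rep_sum rep_rel)

text \<open>Since leading terms multiply, a word in the root vectors has a single leading term, and it is
  determined by the content of the word.\<close>

lemma symbol_word: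
  "bounded (wgt (content u)) (symbol (root_word u))"
  "wgt m = wgt (content u) \<Longrightarrow> symbol (root_word u) m = (if m = content u then word_coeff u else 0)"
proof (induction u arbitrary: m)
  case Nil
  have "symbol 1 m = vac m" for m
    using rep_single[of 0 1 vac m] by (simp add: symbol_def) (simp add: zero_word_def)
  { case 1 then show ?case using \<open>\<And>m. symbol 1 m = vac m\<close> by (auto simp: vac_def bounded_def) }
  { case 2 then show ?case using \<open>\<And>m. symbol 1 m = vac m\<close> by (auto simp: vac_def) }
next
  case (Cons i u)
  have eq: "symbol (root_word (i # u)) = rep (root_vec i) (symbol (root_word u))"
    by (rule ext) (simp add: symbol_def rep_mult)
  { case 1 then show ?case unfolding eq
      using rep_root_vec_lead(1)[OF Cons(1), of i] by (simp add: add.commute) }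
  { case 2
    then have "symbol (root_word (i # u)) m = lead_coeff i * torus_mon (unit_exp i) (symbol (root_word u)) m"
      unfolding eq by (intro rep_root_vec_lead(2)[OF Cons(1)]) simp
    also have "symbol (root_word u) (m - unit_exp i)
        = (if m - unit_exp i = content u then word_coeff u else 0)"
      using 2 by (intro Cons(2)) simp
    moreover have "m - unit_exp i = content u \<longleftrightarrow> m = content (i # u)"
      by (auto simp: algebra_simps)
    ultimately show ?case by (auto simp: torus_mon_def) }
qed

section \<open>The weight filtration\<close>

text \<open>The elements that modulo the relations are combinations of words in the root vectors of weight
  less than \<open>n\<close>. Integers serve as indices since a derivation may lower weights.\<close>

inductive_set low :: "int \<Rightarrow> free_alg set" for n where
  rel: "x \<in> rel_ideal r s \<Longrightarrow> x \<in> low n"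
| word: "wgt (content u) < n \<Longrightarrow> x \<in> low n \<Longrightarrow> scale c (root_word u) + x \<in> low n"

lemma low_add: "x \<in> low n \<Longrightarrow> y \<in> low n \<Longrightarrow> x + y \<in> low n"
proof (induction x rule: low.induct)
  case (rel x)
  from rel(2,1) show ?case
  proof (induction y rule: low.induct)
    case (rel y) then show ?case by (auto intro: low.rel rel_add)
  next
    case (word u y c)
    then have "scale c (root_word u) + (x + y) \<in> low n" by (intro low.word)
    then show ?case by (simp add: algebra_simps)
  qed
next
  case (word u x c)
  then have "scale c (root_word u) + (x + y) \<in> low n" by (intro low.word)
  then show ?case by (simp add: algebra_simps)
qed

lemma low_scale: "x \<in> low n \<Longrightarrow> scale c x \<in> low n"
  by (induction x rule: low.induct) (auto intro: low.intros rel_scale simp: scale_add_right)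

lemma low_zero: "0 \<in> low n" by (intro low.rel) simp

lemma low_minus: "x \<in> low n \<Longrightarrow> - x \<in> low n"
  using low_scale[of x n "-1"] by (simp add: scale_minus_left)

lemma low_diff: "x \<in> low n \<Longrightarrow> y \<in> low n \<Longrightarrow> x - y \<in> low n"
  using low_add[of x n "- y"] low_minus by simp

lemma low_sum: "(\<And>a. a \<in> A \<Longrightarrow> F a \<in> low n) \<Longrightarrow> (\<Sum>a\<in>A. F a) \<in> low n"
  by (induction A rule: infinite_finite_induct) (auto intro: low_add low_zero)

lemma low_root_word: "wgt (content u) < n \<Longrightarrow> root_word u \<in> low n"
  using low.word[of u n 0 1] low_zero by simp

lemma low_mono: "x \<in> low n \<Longrightarrow> n \<le> n' \<Longrightarrow> x \<in> low n'"
  by (induction x rule: low.induct) (auto intro: low.intros)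

lemma content_wgt_nonneg: "0 \<le> wgt (content u)"
  by (induction u) (auto intro: add_nonneg_nonneg less_imp_le[OF letter_wgt_pos])

lemma low_nonpos: "x \<in> low n \<Longrightarrow> n \<le> 0 \<Longrightarrow> x \<in> rel_ideal r s"
proof (induction x rule: low.induct)
  case (word u x c) then show ?case using content_wgt_nonneg[of u] by simp
qed

lemma low_mult_left: "x \<in> low n \<Longrightarrow> root_word v * x \<in> low (n + wgt (content v))"
proof (induction x rule: low.induct)
  case (rel x) then show ?case by (intro low.rel rel_mult_left)
next
  case (word u x c)
  then have "scale c (root_word (v @ u)) + root_word v * x \<in> low (n + wgt (content v))"
    by (intro low.word) auto
  then show ?case by (simp add: distrib_left scale_mult_right)
qed

lemma low_mult_right: "x \<in> low n \<Longrightarrow> x * root_word v \<in> low (n + wgt (content v))"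
proof (induction x rule: low.induct)
  case (rel x) then show ?case by (intro low.rel rel_mult_right)
next
  case (word u x c)
  then have "scale c (root_word (u @ v)) + x * root_word v \<in> low (n + wgt (content v))"
    by (intro low.word) auto
  then show ?case by (simp add: distrib_right scale_mult_left)
qed

lemma symbol_low: "x \<in> low n \<Longrightarrow> n \<le> wgt m \<Longrightarrow> symbol x m = 0"
proof (induction x rule: low.induct)
  case (word u x c)
  then show ?case using symbol_word(1)[of u] by (auto simp: bounded_def symbol_add symbol_scale)
qed (simp add: symbol_rel)

text \<open>The top part of a product is the product of the top parts. Multiplication by single letters on
  either side is all that is required to compare coefficients in straightening relations.\<close>

lemma symbol_mult_letter:
  assumes "x \<in> low (n + 1)" "wgt m = n"
  shows "symbol (x * root_vec i) (m + unit_exp i) = lead_coeff i * twist m (unit_exp i) * symbol x m"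
    and "symbol (root_vec i * x) (m + unit_exp i) = lead_coeff i * twist (unit_exp i) m * symbol x m"
  using assms
proof (induction x rule: low.induct)
  case (rel x)
  { case 1 with rel show ?case by (simp add: symbol_rel rel_mult_right) }
  { case 2 with rel show ?case by (simp add: symbol_rel rel_mult_left) }
next
  case (word u x c)
  have *: "symbol (root_word u) m = (if wgt (content u) = n \<and> m = content u then word_coeff u else 0)"
    if "wgt m = n"
    using that symbol_word(2)[of m u] symbol_word(1)[of u] word(1)
    by (cases "wgt (content u) = n") (auto simp: bounded_def)
  have **: "symbol (root_word v) (m + unit_exp i) = (if wgt (content u) = n \<and> m = content u then word_coeff v else 0)"
    if "wgt m = n" "content v = content u + unit_exp i" for v
    using that symbol_word(2)[of "m + unit_exp i" v] symbol_word(1)[of v] word(1)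
    by (cases "wgt (content u) = n") (auto simp: bounded_def)
  have eq: "(scale c (root_word u) + x) * root_vec i = scale c (root_word (u @ [i])) + x * root_vec i"
    "root_vec i * (scale c (root_word u) + x)
      = scale c (root_word (i # u)) + root_vec i * x"
    by (simp_all add: distrib_left distrib_right scale_mult_left scale_mult_right)
  { case 1
    then show ?case
      unfolding eq using word *  **[of "u @ [i]"]
      by (auto simp: symbol_add symbol_scale word_coeff_append algebra_simps) }
  { case 2
    then show ?case
      unfolding eq using word *  **[of "i # u"]
      by (auto simp: symbol_add symbol_scale algebra_simps) }
qed

section \<open>Commutation relations between the root vectors\<close>

text \<open>The definitions of the root vectors, read as rewrite rules that move \<open>e\<^sub>1\<close> and \<open>x3\<close> to the right.\<close>

lemma e1_e2: "e1 * e2 = x5 + scale (s^3) (e2 * e1)"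
  and e1_x5: "e1 * x5 = x3 + scale (r * s^2) (x5 * e1)"
  and e1_x3: "e1 * x3 = x2 + scale (r^2 * s) (x3 * e1)"
  and x3_x5: "x3 * x5 = x4 + scale (r^2 * s) (x5 * x3)"
  by (simp_all add: x5_def x3_def x2_def x4_def)

lemma assoc_rule: "x * y = z \<Longrightarrow> x * (y * w) = z * w" for x y z w :: free_alg
  by (simp flip: mult.assoc)

lemmas skew_rules = e1_e2 e1_x5 e1_x3 x3_x5
  e1_e2[THEN assoc_rule] e1_x5[THEN assoc_rule] e1_x3[THEN assoc_rule] x3_x5[THEN assoc_rule]

lemmas scale_simps = scale_mult_left scale_mult_right scale_diff_right scale_add_right
  scale_diff_left scale_add_left scale_minus_left

text \<open>The straightening relations that are not definitions, written as elements that turn out to lie in the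
  ideal of relations. The name records the indices of the two root vectors. Those of
  \<open>x2, x5\<close> and of \<open>x2, x4\<close> are multiplied by \<open>r + s\<close> to clear denominators.\<close>

definition rel12 where "rel12 = e1 * x2 - scale (r^3) (x2 * e1)"

definition rel56 where "rel56 = x5 * e2 - scale (r^3) (e2 * x5)"

definition rel36 where "rel36 = x3 * e2 - scale (r^3 * s^3) (e2 * x3) - scale (r^3 - r * s^2) (x5 * x5)"

definition rel46 where "rel46 = x4 * e2 - scale (r^6 * s^3) (e2 * x4)
  - scale (r^6 - r^5 * s - r^4 * s^2 + r^3 * s^3) (x5 * x5 * x5)"

definition rel26 where "rel26 = x2 * e2 - scale (r^3 * s^6) (e2 * x2)
  - scale (r^3 - r * s^2 - r^2 * s) (x3 * x5) - scale (r^3 * s^3 + r^4 * s^2 - r^2 * s^4) (x5 * x3)"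

definition rel25 where "rel25 = scale (r + s) (x2 * x5 - scale (r^3 * s^3) (x5 * x2))
  - scale (r^4 - r * s^3) (x3 * x3)"

definition rel23 where "rel23 = x2 * x3 - scale (r^3) (x3 * x2)"

definition rel24 where "rel24 = scale (r + s) (x2 * x4 - scale (r^6 * s^3) (x4 * x2))
  - scale (r^2 * (r - s) * (r^4 - r * s^3)) (x3 * x3 * x3)"

definition rel45 where "rel45 = x4 * x5 - scale (r^3) (x5 * x4)"

definition rel34 where "rel34 = x3 * x4 - scale (r^3) (x4 * x3)"

text \<open>An identity of the free algebra: moving \<open>e\<^sub>1\<close> through \<open>x3\<close> and \<open>x5\<close> uses their definitions alone.\<close>

lemma e1_x4: "e1 * x4 = scale (r^3 * s^3) (x4 * e1) + x2 * x5 - scale (r^3 * s^3) (x5 * x2)"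
proof -
  have "e1 * x4 = e1 * (x3 * x5) - scale (r^2 * s) (e1 * (x5 * x3))"
    by (simp add: x4_def algebra_simps scale_simps)
  then show ?thesis
    by (simp del: x3_x5 add: e1_x5 e1_x3 e1_x5[THEN assoc_rule] e1_x3[THEN assoc_rule] x4_def
      algebra_simps scale_simps power_numeral_reduce)
qed

lemmas cert_simps = skew_rules e1_x4 e1_x4[THEN assoc_rule] algebra_simps scale_simps power_numeral_reduce

text \<open>Certificates of membership in the ideal. Taking the skew commutator of \<open>e\<^sub>1\<close> with the relation of
  \<open>X\<^sub>i\<close> and \<open>X\<^sub>j\<close> produces the relation for a neighbouring pair, because \<open>e\<^sub>1\<close> moves up the chain
  \<open>e\<^sub>2, x5, x3, x2\<close>; the remaining summands remove the terms that are known already. Only the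
  relations of \<open>x4\<close> with \<open>e\<^sub>2\<close> and with \<open>x2\<close> come from the definition of \<open>x4\<close> as a commutator. All of these are
  identities in the free algebra that follow by rewriting.\<close>

lemma cert36: "rel36 = e1 * rel56 - scale (r * s^5) (rel56 * e1)"
  unfolding rel36_def rel56_def by (simp add: cert_simps)

lemma cert46: "rel46 = x3 * rel56 + scale (r^3) (rel36 * x5)
    - scale (r^2 * s) (x5 * rel36 + scale (r^3 * s^3) (rel56 * x3))"
  unfolding rel46_def rel36_def rel56_def by (simp add: cert_simps)

lemma cert26: "rel26 = e1 * rel36 - scale (r^2 * s^4) (rel36 * e1)"
  unfolding rel26_def rel36_def by (simp add: cert_simps)

lemma cert25: "scale (r * s) rel25 = e1 * rel26 - scale (r^3 * s^3) (rel26 * e1) - rel12 * e2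
    + scale (r^3 * s^9) (e2 * rel12)"
  unfolding rel25_def rel26_def rel12_def by (simp add: cert_simps)

lemma cert23: "scale (r * s * (r^2 + s^2)) rel23 = e1 * rel25 - scale (r^4 * s^2) (rel25 * e1)
    - scale (r + s) (rel12 * x5) + scale (r^4 * s^5 * (r + s)) (x5 * rel12)"
  unfolding rel25_def rel23_def rel12_def by (simp add: cert_simps)

lemma cert24: "rel24 = scale (r + s) (rel23 * x5) + scale (r^3) (x3 * rel25)
    - scale (r^2 * s) (rel25 * x3 + scale ((r + s) * r^3 * s^3) (x5 * rel23))"
  unfolding rel25_def rel23_def rel24_def by (simp add: cert_simps)

lemma cert45: "scale (r^2 * s^2 * (r^3 + s^3)) rel45 =
    scale (r + s) (e1 * rel46 - scale (r^3 * s^6) (rel46 * e1)) - rel25 * e2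
    + scale (r^6 * s^6) (e2 * rel25)
    - scale (r^4 - r * s^3) (x3 * rel36 + scale (r^3 * s^3) (rel36 * x3))"
  unfolding rel25_def rel45_def rel46_def rel36_def by (simp add: cert_simps)

lemma cert34: "scale (- (r * s * (r^2 + s^2))) rel34 =
    scale (r + s) (e1 * rel45 - scale (r^4 * s^5) (rel45 * e1)) - rel25 * x5
    + scale (r^4 * s^2) (x5 * rel25)"
  unfolding rel25_def rel45_def rel34_def by (simp add: cert_simps)

lemma rel_unscale: "scale c x \<in> rel_ideal r s \<Longrightarrow> c \<noteq> 0 \<Longrightarrow> x \<in> rel_ideal r s"
  using rel_scale[of "scale c x" r s "1 / c"] by simp

lemmas rel_intros = rel_add rel_diff rel_scale rel_mult_left rel_mult_right

text \<open>Starting from the Serre elements \<open>rel12\<close> and \<open>rel56\<close>, the certificates give one relation after the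
  other. Some of them appear multiplied by a scalar, which is nonzero for generic parameters.\<close>

lemma straightening_relations: "rel12 \<in> rel_ideal r s" "rel56 \<in> rel_ideal r s" "rel36 \<in> rel_ideal r s"
  "rel46 \<in> rel_ideal r s" "rel26 \<in> rel_ideal r s" "rel25 \<in> rel_ideal r s" "rel23 \<in> rel_ideal r s"
  "rel24 \<in> rel_ideal r s" "rel45 \<in> rel_ideal r s" "rel34 \<in> rel_ideal r s"
proof -
  show 12: "rel12 \<in> rel_ideal r s"
    unfolding rel12_def serre12_skew[symmetric] by (rule serre_in_rel)
  show 56: "rel56 \<in> rel_ideal r s"
    unfolding rel56_def serre21_skew[symmetric] by (intro rel_scale serre_in_rel)
  show 36: "rel36 \<in> rel_ideal r s" unfolding cert36 by (intro rel_intros 56)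
  show 46: "rel46 \<in> rel_ideal r s" unfolding cert46 by (intro rel_intros 56 36)
  show 26: "rel26 \<in> rel_ideal r s" unfolding cert26 by (intro rel_intros 36)
  have "scale (r * s) rel25 \<in> rel_ideal r s" unfolding cert25 by (intro rel_intros 26 12)
  then show 25: "rel25 \<in> rel_ideal r s" by (rule rel_unscale) simp
  have "scale (r * s * (r^2 + s^2)) rel23 \<in> rel_ideal r s" unfolding cert23 by (intro rel_intros 25 12)
  then show 23: "rel23 \<in> rel_ideal r s" by (rule rel_unscale) (simp add: generic_nonzero)
  show 24: "rel24 \<in> rel_ideal r s" unfolding cert24 by (intro rel_intros 25 23)
  have "scale (r^2 * s^2 * (r^3 + s^3)) rel45 \<in> rel_ideal r s"
    unfolding cert45 by (intro rel_intros 46 25 36)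
  moreover have "r^3 + s^3 = (r + s) * (r^2 - r * s + s^2)"
    by (simp add: algebra_simps power2_eq_square power3_eq_cube)
  then have "r^2 * s^2 * (r^3 + s^3) \<noteq> 0" using generic_nonzero by simp
  ultimately show 45: "rel45 \<in> rel_ideal r s" by (rule rel_unscale)
  have "scale (- (r * s * (r^2 + s^2))) rel34 \<in> rel_ideal r s"
    unfolding cert34 by (intro rel_intros 45 25)
  then show 34: "rel34 \<in> rel_ideal r s" by (rule rel_unscale) (simp add: generic_nonzero)
qed

text \<open>The scalar \<open>\<chi>(a, b)\<close> with \<open>T\<^sup>a T\<^sup>b = \<chi>(a, b) T\<^sup>b T\<^sup>a\<close>.\<close>

definition comm_factor :: "expo \<Rightarrow> expo \<Rightarrow> complex" where
  "comm_factor a b = twist a b / twist b a"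

lemma comm_factor_nz [simp]: "comm_factor a b \<noteq> 0"
  and comm_factor_self [simp]: "comm_factor a a = 1"
  and comm_factor_swap: "comm_factor b a = 1 / comm_factor a b"
  by (simp_all add: comm_factor_def)

lemma comm_factor_mon: "comm_factor a b = mon (rexp a b - rexp b a) (sexp a b - sexp b a)"
  by (simp add: comm_factor_def twist_def mon_def power_int_diff)

lemma low_rel_plus:
  assumes "x \<in> rel_ideal r s" "\<And>y. y \<in> set ys \<Longrightarrow> y \<in> low n" "z = x + sum_list ys"
  shows "z \<in> low n"
proof -
  have "sum_list ys \<in> low n" using assms(2)
    by (induction ys) (auto intro: low_add low_zero)
  then show ?thesis using assms(1,3) by (auto intro: low_add low.rel)
qed

text \<open>The associated graded algebra is a quantum affine space with the commutation factors of the
  quantum torus.\<close>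

lemma letters_commute_up_to_lower:
  "root_vec i * root_vec j - scale (comm_factor (unit_exp i) (unit_exp j)) (root_vec j * root_vec i)
     \<in> low (letter_wgt i + letter_wgt j)"
proof -
  let ?c = "\<lambda>i j. root_vec i * root_vec j - scale (comm_factor (unit_exp i) (unit_exp j)) (root_vec j * root_vec i)"
  let ?P = "\<lambda>i j. ?c i j \<in> low (letter_wgt i + letter_wgt j)"
  have w: "scale c (root_word u) \<in> low n" if "wgt (content u) < n" for c u n
    using that by (intro low_scale low_root_word)
  note cf = comm_factor_mon mon_def power_int_numeral
  have 12: "?P A1 A2" using straightening_relations(1) by (intro low.rel) (simp add: cf rel12_def)
  have 13: "?P A1 A3" using w[of "[A2]" 4 1] by (simp add: cf e1_x3)
  have 15: "?P A1 A5" using w[of "[A3]" 4 1] by (simp add: cf e1_x5)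
  have 16: "?P A1 A6" using w[of "[A5]" 6 1] by (simp add: cf e1_e2)
  have 23: "?P A2 A3" using straightening_relations(7) by (intro low.rel) (simp add: cf rel23_def)
  have 34: "?P A3 A4" using straightening_relations(10) by (intro low.rel) (simp add: cf rel34_def)
  have 35: "?P A3 A5" using w[of "[A4]" 2 1] by (simp add: cf x3_x5)
  have 45: "?P A4 A5" using straightening_relations(9) by (intro low.rel) (simp add: cf rel45_def)
  have 56: "?P A5 A6" using straightening_relations(2) by (intro low.rel) (simp add: cf rel56_def)
  \<comment> \<open>This pair is bounded by \<open>3\<close> instead of \<open>4\<close>, because the pair \<open>A1, A4\<close> reduces to it.\<close>
  have 25: "?c A2 A5 \<in> low 3"
  proof (rule low_rel_plus[OF rel_scale[OF straightening_relations(6), of "1 / (r + s)"]])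
    show "y \<in> low 3" if "y \<in> set [scale ((r^4 - r * s^3) / (r + s)) (root_word [A3, A3])]" for y
      using that w[of "[A3, A3]" 3] by simp
  qed (use generic_nonzero in \<open>simp add: cf rel25_def scale_diff_right\<close>)
  have 14: "?c A1 A4 \<in> low 3"
  proof -
    have "?c A1 A4 = ?c A2 A5" by (simp add: cf e1_x4)
    with 25 show ?thesis by simp
  qed
  have 24: "?P A2 A4"
  proof (rule low_rel_plus[OF rel_scale[OF straightening_relations(8), of "1 / (r + s)"]])
    let ?y = "scale (r^2 * (r - s) * (r^4 - r * s^3) / (r + s)) (root_word [A3, A3, A3])"
    show "y \<in> low (letter_wgt A2 + letter_wgt A4)" if "y \<in> set [?y]" for y
      using that w[of "[A3, A3, A3]" 4] by simp
    show "?c A2 A4 = scale (1 / (r + s)) rel24 + sum_list [?y]"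
      using generic_nonzero by (simp add: cf rel24_def scale_diff_right mult.assoc)
  qed
  have 26: "?P A2 A6"
  proof (rule low_rel_plus[OF straightening_relations(5)])
    let ?y = "scale (r^3 - r * s^2 - r^2 * s) (root_word [A3, A5])"
    let ?z = "scale (r^3 * s^3 + r^4 * s^2 - r^2 * s^4) (root_word [A5, A3])"
    show "y \<in> low (letter_wgt A2 + letter_wgt A6)" if "y \<in> set [?y, ?z]" for y
      using that w[of "[A3, A5]" 6] w[of "[A5, A3]" 6] by auto
    show "?c A2 A6 = rel26 + sum_list [?y, ?z]"
      by (simp add: cf rel26_def)
  qed
  have 36: "?P A3 A6"
  proof (rule low_rel_plus[OF straightening_relations(3)])
    let ?y = "scale (r^3 - r * s^2) (root_word [A5, A5])"
    show "y \<in> low (letter_wgt A3 + letter_wgt A6)" if "y \<in> set [?y]" for y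
      using that w[of "[A5, A5]" 4] by auto
    show "?c A3 A6 = rel36 + sum_list [?y]" by (simp add: cf rel36_def)
  qed
  have 46: "?P A4 A6"
  proof (rule low_rel_plus[OF straightening_relations(4)])
    let ?y = "scale (r^6 - r^5 * s - r^4 * s^2 + r^3 * s^3) (root_word [A5, A5, A5])"
    show "y \<in> low (letter_wgt A4 + letter_wgt A6)" if "y \<in> set [?y]" for y
      using that w[of "[A5, A5, A5]" 4] by auto
    show "?c A4 A6 = rel46 + sum_list [?y]" by (simp add: cf rel46_def mult.assoc)
  qed
  have 14: "?P A1 A4" and 25: "?P A2 A5"
    using low_mono[OF 14, of 4] low_mono[OF 25, of 4] by simp_all
  have same: "?P i i" for i by (simp add: low_zero)
  have swap: "?P j i" if "?P i j" for i j
  proof -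
    let ?f = "comm_factor (unit_exp i) (unit_exp j)"
    have "?c j i = scale (- (1 / ?f)) (?c i j)"
      by (simp add: scale_diff_right scale_minus_left comm_factor_swap[of "unit_exp j" "unit_exp i"])
    with low_scale[OF that, of "- (1 / ?f)"] show ?thesis by (simp add: add.commute)
  qed
  show ?thesis
    by (cases i; cases j; simp only:)
      (rule same 12 13 14 15 16 23 24 25 26 34 35 36 45 46 56
        swap[OF 12] swap[OF 13] swap[OF 14] swap[OF 15] swap[OF 16] swap[OF 23] swap[OF 24]
        swap[OF 25] swap[OF 26] swap[OF 34] swap[OF 35] swap[OF 36] swap[OF 45] swap[OF 46]
        swap[OF 56])+
qed

section \<open>Straightening\<close>

text \<open>Dividing by the leading coefficient removes the factors \<open>q\<^sub>i\<^sub>j\<close> that reordering produces, so up to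
  lower weight the result depends on the content only.\<close>

definition monic_word :: "letter list \<Rightarrow> free_alg" where
  "monic_word u = scale (1 / word_coeff u) (root_word u)"

definition same_top :: "letter list \<Rightarrow> letter list \<Rightarrow> bool" where
  "same_top u v \<longleftrightarrow> content u = content v \<and> monic_word u - monic_word v \<in> low (wgt (content u))"

lemma same_top_refl: "same_top u u"
  by (simp add: same_top_def low_zero)

lemma same_top_trans: "same_top u v \<Longrightarrow> same_top v w \<Longrightarrow> same_top u w"
  using low_add[of "monic_word u - monic_word v" "wgt (content w)" "monic_word v - monic_word w"]
  by (auto simp: same_top_def)

lemma same_top_sym: "same_top u v \<Longrightarrow> same_top v u"
  using low_minus[of "monic_word u - monic_word v" "wgt (content u)"] by (auto simp: same_top_def)

lemma same_top_Cons: "same_top u v \<Longrightarrow> same_top (i # u) (i # v)"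
proof -
  assume uv: "same_top u v"
  then have eq: "content u = content v" by (simp add: same_top_def)
  let ?k = "1 / (lead_coeff i * twist (unit_exp i) (content v))"
  have "monic_word (i # u) - monic_word (i # v) = scale ?k (root_word [i] * (monic_word u - monic_word v))"
    by (simp add: monic_word_def eq scale_diff_right scale_mult_right right_diff_distrib field_simps)
  moreover have "root_word [i] * (monic_word u - monic_word v) \<in> low (wgt (content u) + letter_wgt i)"
  proof -
    have "monic_word u - monic_word v \<in> low (wgt (content u))" using uv unfolding same_top_def by blast
    from low_mult_left[OF this, of "[i]"] show ?thesis by simp
  qed
  ultimately show ?thesis
    using eq by (simp add: same_top_def low_scale add.commute)
qed

lemma same_top_swap: "same_top (i # j # u) (j # i # u)"
proof -
  let ?c = "root_vec i * root_vec j - scale (comm_factor (unit_exp i) (unit_exp j)) (root_vec j * root_vec i)"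
  have k: "comm_factor (unit_exp i) (unit_exp j) * word_coeff (j # i # u) = word_coeff (i # j # u)"
    by (simp add: twist_add comm_factor_def)
  have k': "1 / word_coeff (j # i # u)
      = 1 / word_coeff (i # j # u) * comm_factor (unit_exp i) (unit_exp j)"
    unfolding k[symmetric] by simp
  have "monic_word (i # j # u) - monic_word (j # i # u) = scale (1 / word_coeff (i # j # u)) (?c * root_word u)"
    unfolding monic_word_def k' by (simp add: scale_diff_right scale_mult_left left_diff_distrib mult.assoc)
  moreover have "?c * root_word u \<in> low (letter_wgt i + letter_wgt j + wgt (content u))"
    by (intro low_mult_right letters_commute_up_to_lower)
  ultimately show ?thesis
    unfolding same_top_def by (simp add: low_scale ac_simps)
qed

lemma same_top_move: "same_top (p @ i # u) (i # p @ u)"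
proof (induction p)
  case (Cons j p)
  then show ?case using same_top_trans[OF same_top_Cons[OF Cons] same_top_swap] by simp
qed (simp add: same_top_refl)

text \<open>Insertion sort: the first letter of one word is moved to the front of the other one.\<close>

lemma same_top_if_same_content: "content u = content v \<Longrightarrow> same_top u v"
proof (induction u arbitrary: v)
  case Nil
  have "count_list v i = 0" for i
    using coord_content[of i v] Nil by (simp flip: Nil)
  then have "v = []" by (metis count_list_0_iff list.set_intros(1) neq_Nil_conv)
  then show ?case by (simp add: same_top_refl)
next
  case (Cons i u)
  have "coord i (content (i # u)) = coord i (content v)" by (simp only: Cons(2))
  then have "int (count_list v i) = int (count_list (i # u) i)" by (simp only: coord_content)
  then have "i \<in> set v" by (metis count_list.simps(2) count_list_0_iff nat.simps(3) of_nat_eq_iff Suc_eq_plus1)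
  then obtain p t where v: "v = p @ i # t" by (meson split_list)
  have "same_top u (p @ t)"
    using Cons(2) by (intro Cons(1)) (simp add: v algebra_simps)
  then have "same_top (i # u) (i # p @ t)" by (rule same_top_Cons)
  moreover have "same_top (i # p @ t) v"
    unfolding v by (rule same_top_sym[OF same_top_move])
  ultimately show ?case by (rule same_top_trans)
qed

text \<open>Some word of content \<open>a\<close>, normalised to have \<open>T\<^sup>a\<close> as leading term. Up to lower weight the
  choice of the word does not matter, so no order of the letters has to be fixed.\<close>

definition basis_mon :: "expo \<Rightarrow> free_alg" where
  "basis_mon a = monic_word (SOME u. content u = a)"

lemma word_basis_mon: "root_word u - scale (word_coeff u) (basis_mon (content u)) \<in> low (wgt (content u))"
proof -
  define v where "v = (SOME v. content v = content u)"
  have v: "content v = content u" unfolding v_def by (rule someI[of _ u]) simp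
  then have "monic_word u - monic_word v \<in> low (wgt (content u))"
    using same_top_if_same_content[of u v] by (simp add: same_top_def)
  then have "scale (word_coeff u) (monic_word u - monic_word v) \<in> low (wgt (content u))" by (rule low_scale)
  then show ?thesis
    by (simp add: scale_diff_right basis_mon_def v_def) (simp add: monic_word_def)
qed

lemma basis_mon:
  assumes "nonneg a"
  shows "basis_mon a \<in> low (wgt a + 1)"
    and "wgt m = wgt a \<Longrightarrow> symbol (basis_mon a) m = (if m = a then 1 else 0)"
proof -
  define v where "v = (SOME v. content v = a)"
  have v: "content v = a" unfolding v_def using nonneg_imp_content[OF assms] by (rule someI_ex)
  have eq: "basis_mon a = scale (1 / word_coeff v) (root_word v)"
    by (simp add: basis_mon_def v_def monic_word_def)
  show "basis_mon a \<in> low (wgt a + 1)"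
    unfolding eq using v by (intro low_scale low_root_word) simp
  show "wgt m = wgt a \<Longrightarrow> symbol (basis_mon a) m = (if m = a then 1 else 0)"
    unfolding eq using v symbol_word(2)[of m v] by (simp add: symbol_scale)
qed

text \<open>The top part of an element can be reconstructed from its symbol. For a single word this is
  \<open>word_basis_mon\<close>, and both sides are linear.\<close>

lemma low_expand:
  assumes "x \<in> low (n + 1)"
  shows "x - (\<Sum>a\<in>level n. scale (symbol x a) (basis_mon a)) \<in> low n"
  using assms
proof (induction x rule: low.induct)
  case (rel x)
  then show ?case by (auto simp: symbol_rel intro: low.rel)
next
  case (word u x c)
  let ?s = "\<lambda>x. \<Sum>a\<in>level n. scale (symbol x a) (basis_mon a)"
  have u: "root_word u - ?s (root_word u) \<in> low n"
  proof (cases "wgt (content u) = n")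
    case True
    have "?s (root_word u) = (\<Sum>a\<in>level n. if a = content u then scale (word_coeff u) (basis_mon a) else 0)"
      by (rule sum.cong) (auto simp: level_def True symbol_word(2))
    also have "\<dots> = scale (word_coeff u) (basis_mon (content u))"
      using finite_level True nonneg_content by (simp add: level_def)
    finally show ?thesis using word_basis_mon[of u] True by simp
  next
    case False
    then have "wgt (content u) < n" using word(1) by simp
    moreover have "?s (root_word u) = 0"
      using symbol_word(1)[of u] calculation by (intro sum.neutral) (auto simp: level_def bounded_def)
    ultimately show ?thesis using low_root_word by simp
  qed
  have *: "(scale c (root_word u) + x) - ?s (scale c (root_word u) + x)
      = scale c (root_word u - ?s (root_word u)) + (x - ?s x)"
    by (simp add: symbol_add symbol_scale scale_add_left sum.distrib scale_diff_right scale_sum)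
  show ?case unfolding * using u word(3) by (intro low_add low_scale)
qed

text \<open>The independence of the ordered monomials in the form in which it is used: an element whose top
  coefficients vanish is of lower weight.\<close>

lemma low_step:
  assumes "x \<in> low (n + 1)" "\<And>m. wgt m = n \<Longrightarrow> symbol x m = 0"
  shows "x \<in> low n"
proof -
  have "(\<Sum>a\<in>level n. scale (symbol x a) (basis_mon a)) = 0"
    by (intro sum.neutral) (auto simp: level_def assms(2))
  with low_expand[OF assms(1)] show ?thesis by simp
qed

text \<open>Negative exponents occur in the quantum torus, but not in leading terms.\<close>

lemma symbol_support:
  assumes "x \<in> low (wgt m + 1)" "\<not> nonneg m"
  shows "symbol x m = 0"
  using assms
proof (induction x rule: low.induct)
  case (word u x c)
  have "symbol (root_word u) m = 0"
    using word(1,4) symbol_word(1)[of u] symbol_word(2)[of m u] nonneg_content[of u]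
    by (cases "wgt (content u) = wgt m") (auto simp: bounded_def)
  with word show ?case by (simp add: symbol_add symbol_scale)
qed (simp add: symbol_rel)

section \<open>The grading\<close>

lemma gen_op_support:
  assumes "\<And>m. f m \<noteq> 0 \<Longrightarrow> dgr m = d" "gen_op g f m \<noteq> 0"
  shows "dgr m = case_gen 1 \<i> g + d"
proof -
  have *: "dgr m = c + d" if "list_all (\<lambda>(k, a). dgr a = c) L" "torus_op L f m \<noteq> 0" for c L
    using that
  proof (induction L)
    case (Cons x L)
    obtain k a where x: "x = (k, a)" by (cases x)
    show ?case
    proof (cases "f (m - a) = 0")
      case True
      then show ?thesis using Cons by (simp add: x torus_op_def torus_mon_def)
    next
      case False
      with assms(1)[of "m - a"] Cons(2) show ?thesis by (simp add: x algebra_simps)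
    qed
  qed (simp add: torus_op_def)
  show ?thesis using assms(2)
    by (cases g) (auto intro!: * simp: torus_e1_def torus_e2_def)
qed

lemma word_op_support: "word_op w vac m \<noteq> 0 \<Longrightarrow> dgr m = deg_weight 1 \<i> (Word w)"
proof (induction w arbitrary: m)
  case Nil then show ?case by (auto simp: vac_def deg_weight_def split: if_splits)
next
  case (Cons g w)
  then have "dgr m = case_gen 1 \<i> g + deg_weight 1 \<i> (Word w)"
    by (intro gen_op_support[of "word_op w vac"]) auto
  then show ?case by (simp add: deg_weight_def)
qed

text \<open>The representation is graded because every term of the images of \<open>e\<^sub>1\<close> and \<open>e\<^sub>2\<close> has the degree of
  the generator.\<close>

lemma symbol_degree_der: "symbol (degree_der 1 \<i> p) m = dgr m * symbol p m"
proof (induction p rule: free_alg_induct)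
  case zero then show ?case by (simp add: degree_der_def symbol_def rep_zero)
next
  case (add w c p)
  have "symbol (degree_der 1 \<i> (Poly_Mapping.single w c)) m = dgr m * symbol (Poly_Mapping.single w c) m"
    using word_op_support[of "letters w" m]
    by (cases "word_op (letters w) vac m = 0") (simp_all add: symbol_def degree_der_def weight_der_single rep_single)
  with add show ?case by (simp add: degree_der_add symbol_add algebra_simps)
qed

lemma homog_root_vectors:
  "homog a b (a + b) x5" "homog a b (2 * a + b) x3" "homog a b (3 * a + b) x2"
  "homog a b (3 * a + 2 * b) x4"
proof -
  have skew: "homog a b d'' (x * y - scale c (y * x))"
    if "homog a b d x" "homog a b d' y" "d + d' = d''" for d d' d'' c x y
    using homog_mult[OF that(1,2)] homog_mult[OF that(2,1)] that(3)
    by (intro homog_diff homog_scale) (simp_all add: add.commute)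
  show 5: "homog a b (a + b) x5"
    unfolding x5_def by (rule skew[OF homog_e1 homog_e2]) simp
  show 3: "homog a b (2 * a + b) x3"
    unfolding x3_def by (rule skew[OF homog_e1 5]) simp
  show 2: "homog a b (3 * a + b) x2"
    unfolding x2_def by (rule skew[OF homog_e1 3]) simp
  show 4: "homog a b (3 * a + 2 * b) x4"
    unfolding x4_def by (rule skew[OF 3 5]) simp
qed

lemma homog_root_vec: "homog 1 \<i> (dgr (unit_exp i)) (root_vec i)"
  using homog_e1[of 1 \<i>] homog_e2[of 1 \<i>] homog_root_vectors[of 1 \<i>]
  by (cases i) (simp_all add: mult.commute)

lemma homog_root_word: "homog 1 \<i> (dgr (content u)) (root_word u)"
  by (induction u) (auto simp: homog_one intro: homog_mult homog_root_vec)

lemma homog_basis_mon: "nonneg a \<Longrightarrow> homog 1 \<i> (dgr a) (basis_mon a)"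
proof -
  assume a: "nonneg a"
  have "content (SOME v. content v = a) = a" using nonneg_imp_content[OF a] by (rule someI_ex)
  then show ?thesis
    using homog_scale[OF homog_root_word[of "SOME v. content v = a"]] by (simp add: basis_mon_def monic_word_def)
qed

text \<open>The elements without component in degree \<open>d\<close>, modulo the relations. With \<open>W\<close> the degree
  derivation they form the image of \<open>W - d\<close>, which describes them without projections to
  homogeneous components.\<close>

definition avoids :: "complex \<Rightarrow> free_alg set" where
  "avoids d = {z. \<exists>y. z - (degree_der 1 \<i> y - scale d y) \<in> rel_ideal r s}"

lemma avoids_add: "x \<in> avoids d \<Longrightarrow> y \<in> avoids d \<Longrightarrow> x + y \<in> avoids d"
proof -
  assume "x \<in> avoids d" "y \<in> avoids d"
  then obtain x' y' where "x - (degree_der 1 \<i> x' - scale d x') \<in> rel_ideal r s"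
    "y - (degree_der 1 \<i> y' - scale d y') \<in> rel_ideal r s" by (auto simp: avoids_def)
  from rel_add[OF this] have "x + y - (degree_der 1 \<i> (x' + y') - scale d (x' + y')) \<in> rel_ideal r s"
    by (simp add: degree_der_add scale_add_right algebra_simps)
  then show ?thesis unfolding avoids_def by blast
qed

lemma avoids_scale: "x \<in> avoids d \<Longrightarrow> scale c x \<in> avoids d"
proof -
  assume "x \<in> avoids d"
  then obtain x' where "x - (degree_der 1 \<i> x' - scale d x') \<in> rel_ideal r s" by (auto simp: avoids_def)
  from rel_scale[OF this, of c]
  have "scale c x - (degree_der 1 \<i> (scale c x') - scale d (scale c x')) \<in> rel_ideal r s"
    by (simp add: degree_der_scale scale_diff_right mult.commute)
  then show ?thesis unfolding avoids_def by blast
qed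

lemma avoids_diff: "x \<in> avoids d \<Longrightarrow> y \<in> avoids d \<Longrightarrow> x - y \<in> avoids d"
  using avoids_add[of x d "scale (-1) y"] avoids_scale[of y d "-1"] by (simp add: scale_minus_left)

lemma avoids_rel: "x \<in> rel_ideal r s \<Longrightarrow> x \<in> avoids d"
  unfolding avoids_def by (intro CollectI exI[of _ 0]) (simp add: degree_der_def)

lemma avoids_sum: "(\<And>a. a \<in> A \<Longrightarrow> F a \<in> avoids d) \<Longrightarrow> (\<Sum>a\<in>A. F a) \<in> avoids d"
  by (induction A rule: infinite_finite_induct) (auto intro: avoids_add avoids_rel)

lemma avoids_homog:
  assumes "homog 1 \<i> d' z" "d' \<noteq> d" shows "z \<in> avoids d"
proof -
  have k: "d' / (d' - d) - d / (d' - d) = 1"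
    using assms(2) by (simp flip: diff_divide_distrib)
  have "degree_der 1 \<i> (scale (1 / (d' - d)) z) - scale d (scale (1 / (d' - d)) z) = z"
    using assms(1) unfolding homog_def degree_der_scale by (simp flip: scale_diff_left add: k)
  then have "z - (degree_der 1 \<i> (scale (1 / (d' - d)) z) - scale d (scale (1 / (d' - d)) z)) = 0"
    by simp
  then show ?thesis unfolding avoids_def using rel_zero[of r s] by (metis (mono_tags, lifting) mem_Collect_eq)
qed

text \<open>Multiplication by a homogeneous element shifts degrees: if \<open>z = (W - d) x\<close> then
  \<open>z y = (W - d - d') (x y)\<close>.\<close>

lemma avoids_mult:
  assumes "z \<in> avoids d" "homog 1 \<i> d' y"
  shows "z * y \<in> avoids (d + d')" "y * z \<in> avoids (d + d')"
proof -
  obtain x where x: "z - (degree_der 1 \<i> x - scale d x) \<in> rel_ideal r s" using assms(1) by (auto simp: avoids_def)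
  have y: "degree_der 1 \<i> y = scale d' y" using assms(2) by (simp add: homog_def)
  have "z * y - (degree_der 1 \<i> (x * y) - scale (d + d') (x * y)) = (z - (degree_der 1 \<i> x - scale d x)) * y"
    by (simp add: degree_der_mult y algebra_simps scale_mult_left scale_mult_right scale_add_left)
  with rel_mult_right[OF x, of y] show "z * y \<in> avoids (d + d')"
    unfolding avoids_def by (intro CollectI exI[of _ "x * y"]) simp
  have "y * z - (degree_der 1 \<i> (y * x) - scale (d + d') (y * x)) = y * (z - (degree_der 1 \<i> x - scale d x))"
    by (simp add: degree_der_mult y algebra_simps scale_mult_left scale_mult_right scale_add_left)
  with rel_mult_left[OF x, of y] show "y * z \<in> avoids (d + d')"
    unfolding avoids_def by (intro CollectI exI[of _ "y * x"]) simp
qed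

lemma symbol_avoids: "z \<in> avoids d \<Longrightarrow> dgr m = d \<Longrightarrow> symbol z m = 0"
proof -
  assume "z \<in> avoids d" and d: "dgr m = d"
  then obtain y where "z - (degree_der 1 \<i> y - scale d y) \<in> rel_ideal r s" by (auto simp: avoids_def)
  from symbol_rel[OF this, of m] show ?thesis by (simp add: symbol_diff symbol_degree_der symbol_scale d)
qed

text \<open>If a degree is spanned by a single word, it suffices to subtract the term of this word.\<close>

lemma remove_word_avoids:
  assumes only: "\<And>w. deg_weight 1 \<i> w = d \<Longrightarrow> w = v"
  shows "p - scale (Poly_Mapping.lookup p v) (Poly_Mapping.single v 1) \<in> avoids d"
    (is "?z \<in> _")
proof -
  \<comment> \<open>The inverse of \<open>W - d\<close> on words of degree other than \<open>d\<close>.\<close>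
  define y where "y = Poly_Mapping.mapp
    (\<lambda>w c. if deg_weight 1 \<i> w = d then 0 else c / (deg_weight 1 \<i> w - d)) ?z"
  have "?z = degree_der 1 \<i> y - scale d y"
  proof (rule poly_mapping_eqI)
    fix w
    have zw: "Poly_Mapping.lookup ?z w = 0" if "w = v"
      using that by (simp add: lookup_minus lookup_scale)
    have yw: "Poly_Mapping.lookup y w = (if deg_weight 1 \<i> w = d then 0
        else Poly_Mapping.lookup ?z w / (deg_weight 1 \<i> w - d))"
      by (simp add: y_def lookup_mapp when_def in_keys_iff)
    show "Poly_Mapping.lookup ?z w = Poly_Mapping.lookup (degree_der 1 \<i> y - scale d y) w"
      using zw only[of w] unfolding degree_der_def lookup_minus[of "weight_der (deg_weight 1 \<i>) y"]
        lookup_weight_der lookup_scale[of d] yw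
      by (auto simp flip: left_diff_distrib)
  qed
  then have "?z - (degree_der 1 \<i> y - scale d y) = 0" by simp
  then show ?thesis unfolding avoids_def using rel_zero[of r s] by (metis (mono_tags, lifting) mem_Collect_eq)
qed

section \<open>Derivations modulo the relations\<close>

text \<open>The lifts of derivations of \<open>U\<^sup>+\<close> to maps of the free algebra. The equations hold only modulo the
  relations, since a lift is an arbitrary choice of representatives.\<close>

definition mod_der :: "(free_alg \<Rightarrow> free_alg) \<Rightarrow> bool" where
  "mod_der D \<longleftrightarrow>
     (\<forall>x y. D (x + y) - (D x + D y) \<in> rel_ideal r s) \<and>
     (\<forall>c x. D (scale c x) - scale c (D x) \<in> rel_ideal r s) \<and>
     (\<forall>x y. D (x * y) - (D x * y + x * D y) \<in> rel_ideal r s) \<and>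
     (\<forall>x\<in>rel_ideal r s. D x \<in> rel_ideal r s)"

lemma mod_der_diff: "mod_der D \<Longrightarrow> mod_der E \<Longrightarrow> mod_der (\<lambda>x. D x - E x)"
  unfolding mod_der_def
proof (intro conjI allI ballI; elim conjE)
  fix x y c
  assume *: "\<forall>x y. D (x + y) - (D x + D y) \<in> rel_ideal r s"
    "\<forall>x y. E (x + y) - (E x + E y) \<in> rel_ideal r s"
  show "D (x + y) - E (x + y) - (D x - E x + (D y - E y)) \<in> rel_ideal r s"
    using rel_diff[OF *(1)[rule_format, of x y] *(2)[rule_format, of x y]] by (simp add: algebra_simps)
next
  fix x c
  assume *: "\<forall>c x. D (scale c x) - scale c (D x) \<in> rel_ideal r s"
    "\<forall>c x. E (scale c x) - scale c (E x) \<in> rel_ideal r s"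
  show "D (scale c x) - E (scale c x) - scale c (D x - E x) \<in> rel_ideal r s"
    using rel_diff[OF *(1)[rule_format, of c x] *(2)[rule_format, of c x]]
    by (simp add: algebra_simps scale_diff_right)
next
  fix x y
  assume *: "\<forall>x y. D (x * y) - (D x * y + x * D y) \<in> rel_ideal r s"
    "\<forall>x y. E (x * y) - (E x * y + x * E y) \<in> rel_ideal r s"
  show "D (x * y) - E (x * y) - ((D x - E x) * y + x * (D y - E y)) \<in> rel_ideal r s"
    using rel_diff[OF *(1)[rule_format, of x y] *(2)[rule_format, of x y]] by (simp add: algebra_simps)
qed (auto intro: rel_diff)

definition ad :: "free_alg \<Rightarrow> free_alg \<Rightarrow> free_alg" where
  "ad g x = g * x - x * g"

lemma mod_der_ad: "mod_der (ad g)"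
  unfolding mod_der_def ad_def
  by (auto simp: algebra_simps scale_mult_left scale_mult_right scale_diff_right
      intro: rel_diff rel_mult_left rel_mult_right)

lemma mod_der_degree_der: "mod_der (degree_der a b)"
  unfolding mod_der_def by (auto simp: degree_der_add degree_der_scale degree_der_mult intro: degree_der_rel)

lemma low_cong: "x - y \<in> rel_ideal r s \<Longrightarrow> y \<in> low n \<Longrightarrow> x \<in> low n"
  using low_add[OF low.rel, of "x - y" y] by simp

lemma avoids_cong: "x - y \<in> rel_ideal r s \<Longrightarrow> y \<in> avoids d \<Longrightarrow> x \<in> avoids d"
  using avoids_add[OF avoids_rel, of "x - y" y] by simp

context
  fixes D assumes D: "mod_der D"
begin

lemma D_add: "D (x + y) - (D x + D y) \<in> rel_ideal r s"
  and D_scale: "D (scale c x) - scale c (D x) \<in> rel_ideal r s"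
  and D_mult: "D (x * y) - (D x * y + x * D y) \<in> rel_ideal r s"
  and D_rel: "x \<in> rel_ideal r s \<Longrightarrow> D x \<in> rel_ideal r s"
  using D by (auto simp: mod_der_def)

lemma D_one: "D 1 \<in> rel_ideal r s"
  using D_mult[of 1 1] rel_minus[of "- D 1"] by simp

lemma D_diff: "D (x - y) - (D x - D y) \<in> rel_ideal r s"
  using rel_add[OF D_add[of x "scale (-1) y"] D_scale[of "-1" y]]
  by (simp add: scale_minus_left algebra_simps)

lemma vanish_on_generators:
  assumes "D e1 \<in> rel_ideal r s" "D e2 \<in> rel_ideal r s"
  shows "D x \<in> rel_ideal r s"
proof -
  have t: "x \<in> rel_ideal r s" if "x - y \<in> rel_ideal r s" "y \<in> rel_ideal r s" for x y
    using rel_add[OF that] by simp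
  have "x \<in> {x. D x \<in> rel_ideal r s}"
    by (rule free_alg_generated)
      (use assms in \<open>auto intro: t[OF D_add] t[OF D_mult] t[OF D_scale] D_one rel_add rel_scale
        rel_mult_left rel_mult_right\<close>)
  then show ?thesis by simp
qed

lemma D_word_low:
  assumes "\<And>i. D (root_vec i) \<in> low (N + letter_wgt i + 1)"
  shows "D (root_word u) \<in> low (N + wgt (content u) + 1)"
proof (induction u)
  case Nil then show ?case using D_one by (auto intro: low.rel)
next
  case (Cons i u)
  have "D (root_vec i) * root_word u \<in> low (N + wgt (content (i # u)) + 1)"
    using low_mult_right[OF assms[of i], of u] by (simp add: algebra_simps)
  moreover have "root_vec i * D (root_word u) \<in> low (N + wgt (content (i # u)) + 1)"
    using low_mult_left[OF Cons, of "[i]"] by (simp add: algebra_simps)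
  ultimately show ?case
    using low_cong[OF D_mult[of "root_vec i" "root_word u"]] low_add by simp
qed

text \<open>It suffices to know the effect on the root vectors: a bound on how far their weights are raised is
  inherited by the whole filtration.\<close>

lemma D_low:
  assumes "\<And>i. D (root_vec i) \<in> low (N + letter_wgt i + 1)" "x \<in> low n"
  shows "D x \<in> low (N + n)"
  using assms(2)
proof (induction x rule: low.induct)
  case (rel x) then show ?case by (auto intro: low.rel D_rel)
next
  case (word u x c)
  have "D (root_word u) \<in> low (N + n)"
    using low_mono[OF D_word_low[OF assms(1), of u], of "N + n"] word(1) by simp
  then have "D (scale c (root_word u)) \<in> low (N + n)"
    by (intro low_cong[OF D_scale] low_scale)
  with word show ?case by (intro low_cong[OF D_add] low_add)
qed

text \<open>Dividing by the leading coefficient of \<open>X\<^sub>i T\<^sup>l\<close> makes the relation below symmetric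
  in \<open>i\<close> and \<open>j\<close>. For \<open>D = ad (T\<^sup>l)\<close> the value is \<open>\<chi>(l, \<epsilon>\<^sub>i) - 1\<close>.\<close>

definition top_coeff :: "letter \<Rightarrow> expo \<Rightarrow> complex" where
  "top_coeff i l = symbol (D (root_vec i)) (l + unit_exp i) / (lead_coeff i * twist (unit_exp i) l)"

text \<open>The derivation is applied to the straightening relation of \<open>X\<^sub>i\<close> and \<open>X\<^sub>j\<close>; its lower terms do not
  reach the weight at which coefficients are compared.\<close>

lemma top_coeff_relation:
  assumes lev: "\<And>i. D (root_vec i) \<in> low (N + letter_wgt i + 1)" and l: "wgt l = N"
  shows "top_coeff i l * (comm_factor l (unit_exp j) - 1)
       = top_coeff j l * (comm_factor l (unit_exp i) - 1)"
proof -
  let ?q = "comm_factor (unit_exp i) (unit_exp j)"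
  let ?z = "root_vec i * root_vec j - scale ?q (root_vec j * root_vec i)"
  let ?m = "l + unit_exp i + unit_exp j"
  let ?y = "D (root_vec i) * root_vec j + root_vec i * D (root_vec j)
    - scale ?q (D (root_vec j) * root_vec i + root_vec j * D (root_vec i))"
  \<comment> \<open>\<open>?z\<close> is a combination of words of weight less than that of \<open>X\<^sub>i X\<^sub>j\<close>, so \<open>D ?z\<close> has no term at \<open>?m\<close>.\<close>
  have "D ?z \<in> low (N + (letter_wgt i + letter_wgt j))"
    by (rule D_low[OF lev letters_commute_up_to_lower])
  then have "symbol (D ?z) ?m = 0" by (rule symbol_low) (simp add: l)
  moreover have "D ?z - ?y \<in> rel_ideal r s"
  proof -
    have "D (scale ?q (root_vec j * root_vec i))
        - scale ?q (D (root_vec j) * root_vec i + root_vec j * D (root_vec i)) \<in> rel_ideal r s"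
      using rel_add[OF D_scale[of ?q "root_vec j * root_vec i"] rel_scale[OF D_mult[of "root_vec j" "root_vec i"], of ?q]]
      by (simp add: scale_diff_right)
    from rel_diff[OF rel_add[OF D_diff[of "root_vec i * root_vec j" "scale ?q (root_vec j * root_vec i)"]
        D_mult[of "root_vec i" "root_vec j"]] this]
    show ?thesis by (simp add: algebra_simps)
  qed
  then have "symbol (D ?z) ?m = symbol ?y ?m" using symbol_rel[of "D ?z - ?y" ?m] by (simp add: symbol_diff)
  ultimately have "symbol ?y ?m = 0" by simp
  have i: "D (root_vec i) \<in> low (N + letter_wgt i + 1)" and j: "D (root_vec j) \<in> low (N + letter_wgt j + 1)"
    by (rule lev)+
  have mj: "wgt (l + unit_exp i) = N + letter_wgt i" and mi: "wgt (l + unit_exp j) = N + letter_wgt j"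
    by (simp_all add: l)
  have m: "?m = l + unit_exp j + unit_exp i" by (simp add: algebra_simps)
  let ?a = "symbol (D (root_vec i)) (l + unit_exp i)" and ?b = "symbol (D (root_vec j)) (l + unit_exp j)"
  have "lead_coeff j * twist (l + unit_exp i) (unit_exp j) * ?a
      + lead_coeff i * twist (unit_exp i) (l + unit_exp j) * ?b
      - ?q * (lead_coeff i * twist (l + unit_exp j) (unit_exp i) * ?b
        + lead_coeff j * twist (unit_exp j) (l + unit_exp i) * ?a) = 0"
    using \<open>symbol ?y ?m = 0\<close> symbol_mult_letter[OF i mj, of j]
      symbol_mult_letter[OF j mi, of i, folded m]
    by (simp add: symbol_add symbol_diff symbol_scale)
  then have "twist (unit_exp i) (unit_exp j) *
      (lead_coeff j * ?a * (twist l (unit_exp j) - twist (unit_exp j) l)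
      - lead_coeff i * ?b * (twist l (unit_exp i) - twist (unit_exp i) l)) = 0"
    by (simp add: twist_add comm_factor_def algebra_simps)
  then have "lead_coeff j * ?a * (twist l (unit_exp j) - twist (unit_exp j) l)
      = lead_coeff i * ?b * (twist l (unit_exp i) - twist (unit_exp i) l)"
    by simp
  moreover have "top_coeff i l * (comm_factor l (unit_exp j) - 1)
      = lead_coeff j * ?a * (twist l (unit_exp j) - twist (unit_exp j) l)
        / (lead_coeff i * lead_coeff j * twist (unit_exp i) l * twist (unit_exp j) l)"
    by (simp add: top_coeff_def comm_factor_def divide_simps)
  moreover have "top_coeff j l * (comm_factor l (unit_exp i) - 1)
      = lead_coeff i * ?b * (twist l (unit_exp i) - twist (unit_exp i) l)
        / (lead_coeff i * lead_coeff j * twist (unit_exp i) l * twist (unit_exp j) l)"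
    by (simp add: top_coeff_def comm_factor_def divide_simps)
  ultimately show ?thesis by simp
qed

end

lemma mod_der_add: "mod_der D \<Longrightarrow> mod_der E \<Longrightarrow> mod_der (\<lambda>x. D x + E x)"
  and mod_der_scale: "mod_der D \<Longrightarrow> mod_der (\<lambda>x. scale c (D x))"
  and mod_der_zero: "mod_der (\<lambda>x. 0)"
proof -
  show zero: "mod_der (\<lambda>x. 0)" by (simp add: mod_der_def)
  show "mod_der (\<lambda>x. D x + E x)" if "mod_der D" "mod_der E" for D E
    using mod_der_diff[OF that(1) mod_der_diff[OF zero that(2)]] by simp
  show "mod_der (\<lambda>x. scale c (D x))" if "mod_der D" for D
    unfolding mod_der_def
  proof (intro conjI allI ballI)
    fix x y
    show "scale c (D (x + y)) - (scale c (D x) + scale c (D y)) \<in> rel_ideal r s"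
      using rel_scale[OF D_add[OF that, of x y], of c] by (simp add: scale_diff_right scale_add_right)
    show "scale c (D (x * y)) - (scale c (D x) * y + x * scale c (D y)) \<in> rel_ideal r s"
      using rel_scale[OF D_mult[OF that, of x y], of c]
      by (simp add: scale_diff_right scale_add_right scale_mult_left scale_mult_right)
    fix k show "scale c (D (scale k x)) - scale k (scale c (D x)) \<in> rel_ideal r s"
      using rel_scale[OF D_scale[OF that, of k x], of c] by (simp add: scale_diff_right mult.commute)
  qed (intro rel_scale D_rel[OF that])
qed

lemma mod_der_minus: "mod_der D \<Longrightarrow> mod_der (\<lambda>x. - D x)"
  using mod_der_diff[OF mod_der_zero] by simp

section \<open>Every derivation is inner up to degree derivations\<close>

text \<open>The arithmetic core. Commuting with \<open>T\<^sub>j\<close> imposes two linear equations on \<open>l\<close>, one for the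
  exponent of \<open>r\<close> and one for that of \<open>s\<close>. The ten equations for any five of the generators have
  rank six.\<close>

lemma comm_factor_trivial:
  assumes "\<And>j. j \<noteq> k \<Longrightarrow> comm_factor l (unit_exp j) = 1"
  shows "l = 0"
proof -
  obtain l1 l2 l3 l4 l5 l6 where l: "l = (l1, l2, l3, l4, l5, l6)" by (cases l)
  have "rexp l (unit_exp j) - rexp (unit_exp j) l = 0 \<and> sexp l (unit_exp j) - sexp (unit_exp j) l = 0"
    if "j \<noteq> k" for j
    using assms[OF that] by (simp add: comm_factor_mon mon_eq_1_iff)
  note * = this[of A1] this[of A2] this[of A3] this[of A4] this[of A5] this[of A6]
  have "l1 = 0 \<and> l2 = 0 \<and> l3 = 0 \<and> l4 = 0 \<and> l5 = 0 \<and> l6 = 0"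
    using * by (cases k) (auto simp: l)
  then show ?thesis by (simp add: l zero_prod_def)
qed

text \<open>If \<open>l\<close> has a negative entry at \<open>i\<close>, then \<open>l + \<epsilon>\<^sub>j\<close> is an exponent of an actual monomial for \<open>j = i\<close> at most.
  A nonzero coefficient there would force \<open>T\<^sup>l\<close> to commute with the five other generators.\<close>

lemma top_coeff_support:
  assumes D: "mod_der D" and lev: "\<And>i. D (root_vec i) \<in> low (N + letter_wgt i + 1)"
    and l: "wgt l = N" "\<not> nonneg l"
  shows "top_coeff D k l = 0"
proof (rule ccontr)
  assume k: "top_coeff D k l \<noteq> 0"
  have nonneg: "nonneg (l + unit_exp j)" if "top_coeff D j l \<noteq> 0" for j
  proof (rule ccontr)
    assume "\<not> nonneg (l + unit_exp j)"
    moreover have "D (root_vec j) \<in> low (wgt (l + unit_exp j) + 1)" using lev[of j] by (simp add: l)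
    ultimately have "symbol (D (root_vec j)) (l + unit_exp j) = 0" by (intro symbol_support)
    with that show False by (simp add: top_coeff_def[OF D])
  qed
  obtain i where i: "coord i l < 0" using l(2) by (auto simp: nonneg_def not_le)
  have eq: "j = i" if "top_coeff D j l \<noteq> 0" for j
  proof (rule ccontr)
    assume "j \<noteq> i"
    then have "coord i (l + unit_exp j) = coord i l" by (simp add: coord_unit_exp)
    with nonneg[OF that] i show False by (metis nonneg_def not_le)
  qed
  have "comm_factor l (unit_exp j) = 1" if "j \<noteq> k" for j
  proof -
    have "top_coeff D j l = 0" using eq[of j] eq[OF k] that by blast
    with top_coeff_relation[OF D lev l(1), where i = k and j = j] k show ?thesis by simp
  qed
  then have "l = 0" by (rule comm_factor_trivial)
  with l(2) show False by (simp add: nonneg_def)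
qed

text \<open>Having no component of degree zero is inherited from the generators by all root vectors, as these
  are iterated skew commutators of homogeneous elements.\<close>

lemma avoids_generators:
  assumes D: "mod_der D" and gen: "D e1 \<in> avoids 1" "D e2 \<in> avoids \<i>"
  shows "D (root_vec i) \<in> avoids (dgr (unit_exp i))"
proof -
  let ?P = "\<lambda>d x. homog 1 \<i> d x \<and> D x \<in> avoids d"
  have mult: "?P (d + d') (x * y)" if "?P d x" "?P d' y" for d d' x y
  proof -
    have "D x * y \<in> avoids (d + d')" "x * D y \<in> avoids (d + d')"
      using avoids_mult(1)[of "D x" d d' y] avoids_mult(2)[of "D y" d' d x] that
      by (simp_all add: add.commute)
    then show ?thesis
      using that by (auto intro: homog_mult avoids_cong[OF D_mult[OF D]] avoids_add)
  qed
  have skew: "?P (d + d') (x * y - scale c (y * x))" if "?P d x" "?P d' y" for d d' c x y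
  proof -
    have xy: "?P (d + d') (x * y)" and yx: "?P (d + d') (y * x)"
      using mult[OF that] mult[OF that(2,1)] by (simp_all add: add.commute)
    then have "D (scale c (y * x)) \<in> avoids (d + d')"
      by (intro avoids_cong[OF D_scale[OF D]] avoids_scale) simp
    then show ?thesis
      using xy yx by (auto intro: homog_diff homog_scale avoids_cong[OF D_diff[OF D]] avoids_diff)
  qed
  have 1: "?P 1 e1" and 6: "?P \<i> e2" using gen homog_e1 homog_e2 by auto
  have 5: "?P (1 + \<i>) x5" unfolding x5_def by (rule skew[OF 1 6])
  have 3: "?P (1 + (1 + \<i>)) x3" unfolding x3_def by (rule skew[OF 1 5])
  have 2: "?P (1 + (1 + (1 + \<i>))) x2" unfolding x2_def by (rule skew[OF 1 3])
  have 4: "?P (1 + (1 + \<i>) + (1 + \<i>)) x4" unfolding x4_def by (rule skew[OF 3 5])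
  have "dgr (unit_exp A1) = 1" "dgr (unit_exp A6) = \<i>" "dgr (unit_exp A5) = 1 + \<i>"
    "dgr (unit_exp A3) = 1 + (1 + \<i>)" "dgr (unit_exp A2) = 1 + (1 + (1 + \<i>))"
    "dgr (unit_exp A4) = 1 + (1 + \<i>) + (1 + \<i>)" by simp_all
  with 1 2 3 4 5 6 show ?thesis by (cases i) (simp_all del: dgr.simps unit_exp.simps)
qed

text \<open>The top part of a derivation without component of degree zero is inner. The coefficient of
  \<open>T\<^sup>l\<close> in \<open>g\<close> is determined by any generator that does not commute with \<open>T\<^sup>l\<close>; by
  \<open>top_coeff_relation\<close> all other generators agree.\<close>

lemma descent_step:
  assumes D: "mod_der D" and lev: "\<And>i. D (root_vec i) \<in> low (N + letter_wgt i + 1)"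
    and avoid: "\<And>i. D (root_vec i) \<in> avoids (dgr (unit_exp i))"
  shows "\<exists>g. \<forall>i. D (root_vec i) - ad g (root_vec i) \<in> low (N + letter_wgt i) \<inter> avoids (dgr (unit_exp i))"
proof -
  define pick where "pick l = (SOME j. comm_factor l (unit_exp j) \<noteq> 1)" for l
  have pick: "comm_factor l (unit_exp (pick l)) \<noteq> 1" if "l \<noteq> 0" for l
  proof -
    have "\<exists>j. comm_factor l (unit_exp j) \<noteq> 1"
      using comm_factor_trivial[where l = l and k = A1] that by blast
    then show ?thesis unfolding pick_def by (rule someI_ex)
  qed
  \<comment> \<open>\<open>ad (T\<^sup>l)\<close> has the top coefficients \<open>\<chi>(l, \<epsilon>\<^sub>i) - 1\<close>.\<close>
  define d where "d l = top_coeff D (pick l) l / (comm_factor l (unit_exp (pick l)) - 1)" for l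
  define g where "g = (\<Sum>l\<in>level N - {0}. scale (d l) (basis_mon l))"
  have glow: "g \<in> low (N + 1)"
    unfolding g_def using basis_mon(1) by (intro low_sum low_scale) (auto simp: level_def)
  have symbol_g: "symbol g l = (if nonneg l \<and> l \<noteq> 0 then d l else 0)" if l: "wgt l = N" for l
  proof -
    have "symbol g l = (\<Sum>a\<in>level N - {0}. if l = a then d a else 0)"
      unfolding g_def symbol_sum using l
      by (intro sum.cong) (auto simp: level_def symbol_scale basis_mon(2))
    also have "\<dots> = (if nonneg l \<and> l \<noteq> 0 then d l else 0)"
      using finite_level[of N] l by (simp add: level_def)
    finally show ?thesis .
  qed
  have "D (root_vec i) - ad g (root_vec i) \<in> low (N + letter_wgt i)" for i
  proof (rule low_step)
    have "root_word [i] * g \<in> low (N + 1 + wgt (content [i]))" "g * root_word [i] \<in> low (N + 1 + wgt (content [i]))"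
      by (intro low_mult_left low_mult_right glow)+
    then have "ad g (root_vec i) \<in> low (N + letter_wgt i + 1)"
      unfolding ad_def by (intro low_diff) (simp_all add: algebra_simps)
    then show "D (root_vec i) - ad g (root_vec i) \<in> low (N + letter_wgt i + 1)" using lev by (intro low_diff)
    fix m assume m: "wgt m = N + letter_wgt i"
    define l where "l = m - unit_exp i"
    have l: "wgt l = N" and ml: "m = l + unit_exp i" by (simp_all add: l_def m)
    let ?k = "lead_coeff i * twist (unit_exp i) l"
    have ad: "symbol (ad g (root_vec i)) m = ?k * ((comm_factor l (unit_exp i) - 1) * symbol g l)"
      unfolding ad_def ml using symbol_mult_letter[OF glow l, of i]
      by (simp add: symbol_diff comm_factor_def algebra_simps)
    have Dm: "symbol (D (root_vec i)) m = ?k * top_coeff D i l"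
      by (simp add: top_coeff_def[OF D] ml)
    have "top_coeff D i l = (comm_factor l (unit_exp i) - 1) * symbol g l"
    proof (cases "nonneg l")
      case False
      with symbol_g[OF l] top_coeff_support[OF D lev l False] show ?thesis by simp
    next
      case True
      show ?thesis
      proof (cases "l = 0")
        case True
        with symbol_g[OF l] symbol_avoids[OF avoid, of "unit_exp i" i] show ?thesis
          by (simp add: top_coeff_def[OF D])
      next
        case False
        with symbol_g[OF l] True have "symbol g l = d l" by simp
        have "comm_factor l (unit_exp (pick l)) - 1 \<noteq> 0" using pick[OF False] by simp
        then have "top_coeff D i l = (comm_factor l (unit_exp i) - 1) * d l"
          using top_coeff_relation[OF D lev l, where i = i and j = "pick l"]
          unfolding d_def by (simp only: times_divide_eq_right nonzero_eq_divide_eq mult.commute not_False_eq_True)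
        with \<open>symbol g l = d l\<close> show ?thesis by simp
      qed
    qed
    with ad Dm show "symbol (D (root_vec i) - ad g (root_vec i)) m = 0" by (simp add: symbol_diff)
  qed
  moreover have "ad g (root_vec i) \<in> avoids (dgr (unit_exp i))" for i
  proof -
    have h: "ad (basis_mon l) (root_vec i) \<in> avoids (dgr (unit_exp i))" if "l \<in> level N - {0}" for l
    proof (rule avoids_homog)
      have l: "nonneg l" "l \<noteq> 0" using that by (auto simp: level_def)
      show "homog 1 \<i> (dgr l + dgr (unit_exp i)) (ad (basis_mon l) (root_vec i))"
        unfolding ad_def
        using homog_mult[OF homog_basis_mon[OF l(1)] homog_root_vec[of i]]
          homog_mult[OF homog_root_vec[of i] homog_basis_mon[OF l(1)]]
        by (intro homog_diff) (simp_all add: add.commute)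
      show "dgr l + dgr (unit_exp i) \<noteq> dgr (unit_exp i)" using dgr_nonneg_eq_0[OF l(1)] l(2) by auto
    qed
    have eq: "ad g (root_vec i) = (\<Sum>l\<in>level N - {0}. scale (d l) (ad (basis_mon l) (root_vec i)))"
      by (simp add: ad_def g_def sum_distrib_left sum_distrib_right scale_mult_left scale_mult_right
          scale_diff_right sum_subtractf)
    show ?thesis unfolding eq by (intro avoids_sum avoids_scale h)
  qed
  ultimately show ?thesis using avoid by (intro exI[of _ g]) (auto intro: avoids_diff)
qed

lemma exists_low: "\<exists>n. x \<in> low n"
proof (induction x rule: free_alg_induct)
  case zero then show ?case using low_zero by blast
next
  case (add w c p)
  then obtain n where n: "p \<in> low n" by blast
  have "\<exists>u. Poly_Mapping.single w 1 = root_word u"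
  proof (induction w rule: word_induct)
    case zero
    have "Poly_Mapping.single 0 1 = root_word []" by simp
    then show ?case by blast
  next
    case (Gen1 w)
    then obtain u where "Poly_Mapping.single w 1 = root_word u" by blast
    then have "Poly_Mapping.single (Word [Gen1] + w) 1 = root_word (A1 # u)"
      by (simp add: e1_def mult_single flip: \<open>_ = root_word u\<close>)
    then show ?case by blast
  next
    case (Gen2 w)
    then obtain u where "Poly_Mapping.single w 1 = root_word u" by blast
    then have "Poly_Mapping.single (Word [Gen2] + w) 1 = root_word (A6 # u)"
      by (simp add: e2_def mult_single flip: \<open>_ = root_word u\<close>)
    then show ?case by blast
  qed
  then obtain u where u: "Poly_Mapping.single w 1 = root_word u" by blast
  have "Poly_Mapping.single w c = scale c (root_word u)" by (simp add: scale_single flip: u)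
  moreover have "scale c (root_word u) + p \<in> low (max n (wgt (content u) + 1))"
    using low_mono[OF n] by (intro low.word) auto
  ultimately show ?case by auto
qed

text \<open>The bound on the weights drops until all \<open>D(X\<^sub>i)\<close> lie in the ideal. The offset \<open>3\<close> is the largest
  weight of a root vector; for \<open>k = 0\<close> the hypothesis already places all \<open>D(X\<^sub>i)\<close> in the ideal.\<close>

lemma descent:
  assumes "mod_der D" "\<And>i. D (root_vec i) \<in> low (int k - 3 + letter_wgt i)"
    "\<And>i. D (root_vec i) \<in> avoids (dgr (unit_exp i))"
  shows "\<exists>g. \<forall>i. D (root_vec i) - ad g (root_vec i) \<in> rel_ideal r s"
  using assms
proof (induction k arbitrary: D)
  case 0
  have "D (root_vec i) \<in> rel_ideal r s" for i
  proof (rule low_nonpos[OF 0(2)])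
    show "int 0 - 3 + letter_wgt i \<le> 0" by (cases i) auto
  qed
  then show ?case by (intro exI[of _ 0]) (simp add: ad_def)
next
  case (Suc k)
  have "D (root_vec i) \<in> low ((int k - 3) + letter_wgt i + 1)" for i
    using Suc.prems(2)[of i] by (simp add: algebra_simps)
  from descent_step[OF Suc.prems(1) this Suc.prems(3)] obtain g where
    g: "\<And>i. D (root_vec i) - ad g (root_vec i) \<in> low (int k - 3 + letter_wgt i)"
      "\<And>i. D (root_vec i) - ad g (root_vec i) \<in> avoids (dgr (unit_exp i))" by blast
  from Suc.IH[OF mod_der_diff[OF Suc.prems(1) mod_der_ad] g] obtain h where
    h: "\<And>i. D (root_vec i) - ad g (root_vec i) - ad h (root_vec i) \<in> rel_ideal r s" by blast
  have eq: "D (root_vec i) - ad (g + h) (root_vec i) = D (root_vec i) - ad g (root_vec i) - ad h (root_vec i)" for i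
    by (simp add: ad_def algebra_simps)
  show ?case using h by (intro exI[of _ "g + h"] allI) (simp only: eq)
qed

text \<open>The derivations of weight \<open>(1, 0)\<close> and \<open>(0, 1)\<close> are used here in place of \<open>D\<^sub>5\<close> and \<open>D\<^sub>6\<close>, which are
  combinations of them.\<close>

lemma mod_der_decomposition:
  assumes D: "mod_der D"
  shows "\<exists>a b g. \<forall>x. D x - (scale a (degree_der 1 0 x) + scale b (degree_der 0 1 x) + ad g x) \<in> rel_ideal r s"
proof -
  \<comment> \<open>With these coefficients \<open>E\<close> has no component of degree zero.\<close>
  define a where "a = Poly_Mapping.lookup (D e1) (Word [Gen1])"
  define b where "b = Poly_Mapping.lookup (D e2) (Word [Gen2])"
  define E where "E x = D x - scale a (degree_der 1 0 x) - scale b (degree_der 0 1 x)" for x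
  have E: "mod_der E"
    unfolding E_def by (intro mod_der_diff mod_der_scale mod_der_degree_der D)
  have "E e1 = D e1 - scale a e1" "E e2 = D e2 - scale b e2"
    by (simp_all add: E_def degree_der_e1 degree_der_e2)
  then have "E e1 \<in> avoids 1" "E e2 \<in> avoids \<i>"
    using remove_word_avoids[of 1 "Word [Gen1]" "D e1"] remove_word_avoids[of \<i> "Word [Gen2]" "D e2"]
    by (simp_all add: a_def b_def deg_weight_eq_gen flip: e1_def e2_def)
  then have avoid: "E (root_vec i) \<in> avoids (dgr (unit_exp i))" for i
    by (rule avoids_generators[OF E])
  have "\<forall>i. \<exists>n. E (root_vec i) \<in> low n" using exists_low by blast
  then obtain n where n: "\<And>i. E (root_vec i) \<in> low (n i)" by metis
  define k where "k = nat (Max (range n) + 3)"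
  have "finite (range n)"
  proof -
    have "(UNIV :: letter set) = {A1, A2, A3, A4, A5, A6}" using letter.exhaust by auto
    then have "finite (UNIV :: letter set)" by (metis finite.emptyI finite_insert)
    then show ?thesis by simp
  qed
  then have "n i \<le> Max (range n)" for i by (intro Max_ge) auto
  moreover have "Max (range n) \<le> int k - 3" unfolding k_def by simp
  ultimately have "n i \<le> int k - 3" for i by (meson order_trans)
  then have "E (root_vec i) \<in> low (int k - 3 + letter_wgt i)" for i
    using letter_wgt_pos[of i] by (intro low_mono[OF n[of i]]) (smt (verit))
  from descent[OF E this avoid] obtain g where g: "\<And>i. E (root_vec i) - ad g (root_vec i) \<in> rel_ideal r s" by blast
  have "E x - ad g x \<in> rel_ideal r s" for x
    by (rule vanish_on_generators[OF mod_der_diff[OF E mod_der_ad]]) (use g[of A1] g[of A6] in simp_all)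
  then show ?thesis
    by (intro exI[of _ a] exI[of _ b] exI[of _ g]) (simp add: E_def algebra_simps)
qed

section \<open>The algebra \<open>U\<^sup>+\<close> and its derivations\<close>

abbreviation U where "U \<equiv> Uplus r s"

definition cls :: "free_alg \<Rightarrow> free_alg set" where
  "cls x = rel_ideal r s +>\<^bsub>free_algebra\<^esub> x"

lemma submodule_rel: "submodule class_ring (rel_ideal r s) free_algebra"
  by (rule submodule.intro) (auto simp: module_free_algebra intro: rel_add rel_scale)

lemma free_minus: "x \<ominus>\<^bsub>free_algebra\<^esub> y = x - y"
  by (simp add: a_minus_def a_inv_free_algebra)

lemma cls_eq_iff: "cls x = cls y \<longleftrightarrow> x - y \<in> rel_ideal r s"
  unfolding cls_def by (subst quot_eq_iff[OF module_free_algebra submodule_rel]) (auto simp: free_minus)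

lemma U_carrier: "carrier U = range cls"
  unfolding Uplus_def cls_def[abs_def] by (simp add: quot_carrier[OF module_free_algebra submodule_rel])

lemma U_add: "cls x \<oplus>\<^bsub>U\<^esub> cls y = cls (x + y)"
  unfolding Uplus_def cls_def by (simp add: quot_add[OF module_free_algebra submodule_rel])

lemma U_zero: "\<zero>\<^bsub>U\<^esub> = cls 0"
  unfolding Uplus_def cls_def by (simp add: quot_zero[OF module_free_algebra submodule_rel])

lemma U_smult: "c \<odot>\<^bsub>U\<^esub> cls x = cls (scale c x)"
  unfolding Uplus_def cls_def by (simp add: quot_smult[OF module_free_algebra submodule_rel])

lemma U_mult: "cls x \<otimes>\<^bsub>U\<^esub> cls y = cls (x * y)"
  unfolding Uplus_def cls_def quot_module_sel
  using ideal.rcoset_mult_add[OF ideal_rel_ideal[of r s], of x y] by simp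

lemma module_U: "Module.module class_ring U"
  unfolding Uplus_def by (rule module_quot_module[OF module_free_algebra submodule_rel])

lemma U_minus: "cls x \<ominus>\<^bsub>U\<^esub> cls y = cls (x - y)"
proof -
  interpret Module.module class_ring U by (rule module_U)
  have "\<ominus>\<^bsub>U\<^esub> cls y = cls (- y)"
    by (rule M.minus_equality) (auto simp: U_add U_zero U_carrier)
  then show ?thesis by (simp add: a_minus_def U_add)
qed

lemmas U_simps = U_carrier U_add U_zero U_smult U_mult U_minus

lemma U_generators: "X1 r s = cls e1" "X6 r s = cls e2" "X5 r s = cls x5" "X3 r s = cls x3"
  "X2 r s = cls x2" "X4 r s = cls x4"
proof -
  show 1: "X1 r s = cls e1" and 6: "X6 r s = cls e2" by (simp_all add: X1_def X6_def cls_def)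
  show 5: "X5 r s = cls x5" by (simp add: X5_def skew_comm_def 1 6 U_simps x5_def)
  show 3: "X3 r s = cls x3" by (simp add: X3_def skew_comm_def 1 5 U_simps x3_def)
  show "X2 r s = cls x2" by (simp add: X2_def skew_comm_def 1 3 U_simps x2_def)
  show "X4 r s = cls x4" by (simp add: X4_def skew_comm_def 5 3 U_simps x4_def)
qed

text \<open>The derivation of \<open>U\<^sup>+\<close> with a given lift.\<close>

definition induced :: "(free_alg \<Rightarrow> free_alg) \<Rightarrow> free_alg set \<Rightarrow> free_alg set" where
  "induced D = (\<lambda>Y\<in>carrier U. cls (D (SOME x. cls x = Y)))"

lemma induced_cls:
  assumes "mod_der D" shows "induced D (cls x) = cls (D x)"
proof -
  define y where "y = (SOME y. cls y = cls x)"
  have "cls y = cls x" unfolding y_def by (rule someI[of _ x]) simp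
  then have "D (y - x) \<in> rel_ideal r s" by (intro D_rel[OF assms]) (simp add: cls_eq_iff)
  then have "D y - D x \<in> rel_ideal r s"
    using rel_diff[OF _ D_diff[OF assms, of y x], of "D (y - x)"] by simp
  moreover have "induced D (cls x) = cls (D y)" by (simp add: induced_def U_carrier y_def)
  ultimately show ?thesis by (simp add: cls_eq_iff)
qed

lemma induced_eq_iff:
  assumes "mod_der D" "mod_der E"
  shows "induced D = induced E \<longleftrightarrow> (\<forall>x. D x - E x \<in> rel_ideal r s)"
proof
  assume "induced D = induced E"
  then have "cls (D x) = cls (E x)" for x using induced_cls assms by metis
  then show "\<forall>x. D x - E x \<in> rel_ideal r s" by (simp add: cls_eq_iff)
next
  assume *: "\<forall>x. D x - E x \<in> rel_ideal r s"
  show "induced D = induced E"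
  proof
    fix Y show "induced D Y = induced E Y"
    proof (cases "Y \<in> carrier U")
      case True
      then obtain x where "Y = cls x" by (auto simp: U_carrier)
      with * show ?thesis by (simp add: cls_eq_iff induced_cls assms)
    qed (simp add: induced_def)
  qed
qed

lemma induced_derivation:
  assumes D: "mod_der D" shows "induced D \<in> derivations class_ring U"
proof -
  note cls_eqI = cls_eq_iff[THEN iffD2]
  have "induced D (cls x \<oplus>\<^bsub>U\<^esub> cls y) = induced D (cls x) \<oplus>\<^bsub>U\<^esub> induced D (cls y)" for x y
    unfolding U_simps induced_cls[OF D] by (rule cls_eqI) (rule D_add[OF D])
  moreover have "induced D (c \<odot>\<^bsub>U\<^esub> cls x) = c \<odot>\<^bsub>U\<^esub> induced D (cls x)" for c x
    unfolding U_simps induced_cls[OF D] by (rule cls_eqI) (rule D_scale[OF D])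
  moreover have "induced D (cls x \<otimes>\<^bsub>U\<^esub> cls y)
      = (induced D (cls x) \<otimes>\<^bsub>U\<^esub> cls y) \<oplus>\<^bsub>U\<^esub> (cls x \<otimes>\<^bsub>U\<^esub> induced D (cls y))" for x y
    unfolding U_simps induced_cls[OF D] by (rule cls_eqI) (rule D_mult[OF D])
  moreover have "induced D \<in> extensional (carrier U)" by (simp add: induced_def)
  ultimately show ?thesis
    by (auto simp: derivations_def LinearCombinations.module_hom_def U_carrier induced_cls[OF D])
qed

lemma derivation_induced:
  assumes "E \<in> derivations class_ring U"
  shows "\<exists>D. mod_der D \<and> E = induced D"
proof -
  have hom: "E \<in> LinearCombinations.module_hom class_ring U U"
    and ext: "E \<in> extensional (carrier U)"
    and mult: "E (cls x \<otimes>\<^bsub>U\<^esub> cls y) = (E (cls x) \<otimes>\<^bsub>U\<^esub> cls y) \<oplus>\<^bsub>U\<^esub> (cls x \<otimes>\<^bsub>U\<^esub> E (cls y))" for x y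
    using assms by (auto simp: derivations_def U_carrier)
  define D where "D x = (SOME y. cls y = E (cls x))" for x
  have D: "E (cls x) = cls (D x)" for x
  proof -
    have "E (cls x) \<in> range cls"
      using hom by (auto simp: LinearCombinations.module_hom_def U_carrier)
    then have "\<exists>y. cls y = E (cls x)" by auto
    from someI_ex[OF this] show ?thesis unfolding D_def by simp
  qed
  have add: "D (x + y) - (D x + D y) \<in> rel_ideal r s" for x y
  proof -
    have "E (cls x \<oplus>\<^bsub>U\<^esub> cls y) = E (cls x) \<oplus>\<^bsub>U\<^esub> E (cls y)"
      using hom by (auto simp: LinearCombinations.module_hom_def U_carrier)
    then show ?thesis by (simp add: D U_simps cls_eq_iff)
  qed
  have scale: "D (scale c x) - scale c (D x) \<in> rel_ideal r s" for c x
  proof -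
    have "E (c \<odot>\<^bsub>U\<^esub> cls x) = c \<odot>\<^bsub>U\<^esub> E (cls x)"
      using hom by (auto simp: LinearCombinations.module_hom_def U_carrier)
    then show ?thesis by (simp add: D U_simps cls_eq_iff)
  qed
  have "mod_der D" unfolding mod_der_def
  proof (intro conjI allI ballI)
    fix x y show "D (x * y) - (D x * y + x * D y) \<in> rel_ideal r s"
      using mult[of x y] by (simp add: D U_simps cls_eq_iff)
  next
    fix x assume "x \<in> rel_ideal r s"
    then have "cls x = cls 0" by (simp add: cls_eq_iff)
    then have "cls (D x) = cls (D 0)" by (simp only: D[symmetric])
    then have "D x - D 0 \<in> rel_ideal r s" by (simp add: cls_eq_iff)
    then show "D x \<in> rel_ideal r s" using rel_add[of "D x - D 0" r s "D 0"] scale[of 0 0] by simp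
  qed (rule add, rule scale)
  moreover have "E = induced D"
  proof
    fix Y show "E Y = induced D Y"
    proof (cases "Y \<in> carrier U")
      case True then show ?thesis by (auto simp: U_carrier induced_cls[OF \<open>mod_der D\<close>] D)
    next
      case False then show ?thesis using ext by (simp add: induced_def extensional_def)
    qed
  qed
  ultimately show ?thesis by blast
qed

text \<open>Derivations of \<open>U\<^sup>+\<close> are thus the same as their lifts up to equality modulo the relations, which makes
  the vector space operations pointwise.\<close>

lemma derivations_eq: "derivations class_ring U = induced ` {D. mod_der D}"
  using induced_derivation derivation_induced by blast

abbreviation Der where "Der \<equiv> der_module class_ring U"

lemma Der_carrier: "carrier Der = induced ` {D. mod_der D}"
  by (simp add: der_module_def derivations_eq)

lemma induced_ext: "mod_der D \<Longrightarrow> induced D = (\<lambda>Y\<in>carrier U. induced D Y)"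
  by (rule ext) (simp add: induced_def)

lemma Der_add: "mod_der D \<Longrightarrow> mod_der E \<Longrightarrow> induced D \<oplus>\<^bsub>Der\<^esub> induced E = induced (\<lambda>x. D x + E x)"
  by (subst induced_ext[of "\<lambda>x. D x + E x"])
    (auto simp: der_module_def U_simps induced_cls mod_der_add intro!: restrict_ext)

lemma Der_smult: "mod_der D \<Longrightarrow> c \<odot>\<^bsub>Der\<^esub> induced D = induced (\<lambda>x. scale c (D x))"
  by (subst induced_ext[of "\<lambda>x. scale c (D x)"])
    (auto simp: der_module_def U_simps induced_cls mod_der_scale intro!: restrict_ext)

lemma Der_zero: "\<zero>\<^bsub>Der\<^esub> = induced (\<lambda>x. 0)"
  by (subst induced_ext)
    (auto simp: der_module_def U_simps induced_cls mod_der_zero intro!: restrict_ext)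

lemmas Der_simps = Der_carrier Der_add Der_smult Der_zero mod_der_add mod_der_scale mod_der_zero

lemma module_Der: "Module.module class_ring Der"
proof (rule module_criteria)
  show "cring (class_ring :: complex ring)" by (rule cring_class)
  show "\<forall>v\<in>carrier Der. \<exists>w\<in>carrier Der. v \<oplus>\<^bsub>Der\<^esub> w = \<zero>\<^bsub>Der\<^esub>"
  proof
    fix v assume "v \<in> carrier Der"
    then obtain D where D: "mod_der D" "v = induced D" by (auto simp: Der_carrier)
    then have "v \<oplus>\<^bsub>Der\<^esub> induced (\<lambda>x. - D x) = \<zero>\<^bsub>Der\<^esub>"
      by (simp add: Der_simps mod_der_minus)
    moreover have "induced (\<lambda>x. - D x) \<in> carrier Der"
      unfolding Der_carrier using D by (intro imageI) (simp add: mod_der_minus)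
    ultimately show "\<exists>w\<in>carrier Der. v \<oplus>\<^bsub>Der\<^esub> w = \<zero>\<^bsub>Der\<^esub>" by blast
  qed
qed (auto simp: Der_simps add_ac scale_add_left scale_add_right intro!: imageI)

lemma inner_eq: "inner_derivations U = range (\<lambda>g. induced (ad g))"
proof -
  have "inner_der U (cls g) = induced (ad g)" for g
    by (subst induced_ext[OF mod_der_ad])
      (auto simp: inner_der_def U_simps induced_cls[OF mod_der_ad] ad_def intro!: restrict_ext)
  then show ?thesis by (simp add: inner_derivations_def U_carrier image_image)
qed

lemma submodule_inner: "submodule class_ring (inner_derivations U) Der"
proof (rule submodule.intro)
  have z: "ad 0 = (\<lambda>x. 0)" by (rule ext) (simp add: ad_def)
  show "\<zero>\<^bsub>Der\<^esub> \<in> inner_derivations U" unfolding inner_eq Der_zero z[symmetric] by (rule rangeI)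
  fix v assume "v \<in> inner_derivations U"
  then obtain g where g: "v = induced (ad g)" by (auto simp: inner_eq)
  { fix w assume "w \<in> inner_derivations U"
    then obtain h where h: "w = induced (ad h)" by (auto simp: inner_eq)
    have "(\<lambda>x. ad g x + ad h x) = ad (g + h)" by (rule ext) (simp add: ad_def algebra_simps)
    then show "v \<oplus>\<^bsub>Der\<^esub> w \<in> inner_derivations U" by (simp add: g h Der_add mod_der_ad inner_eq) }
  { fix c
    have "(\<lambda>x. scale c (ad g x)) = ad (scale c g)"
      by (rule ext) (simp add: ad_def scale_diff_right scale_mult_left scale_mult_right)
    then show "c \<odot>\<^bsub>Der\<^esub> v \<in> inner_derivations U" by (simp add: g Der_smult mod_der_ad inner_eq) }
qed (auto simp: module_Der inner_eq Der_carrier intro: mod_der_ad)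

section \<open>The derivations \<open>D\<^sub>5\<close> and \<open>D\<^sub>6\<close>\<close>

lemma induced_degree_der: "homog a b d x \<Longrightarrow> induced (degree_der a b) (cls x) = d \<odot>\<^bsub>U\<^esub> cls x"
  by (simp add: induced_cls[OF mod_der_degree_der] homog_def U_smult)

lemma induced_degree_der_root_vectors:
  "induced (degree_der a b) (X1 r s) = a \<odot>\<^bsub>U\<^esub> X1 r s"
  "induced (degree_der a b) (X2 r s) = (3 * a + b) \<odot>\<^bsub>U\<^esub> X2 r s"
  "induced (degree_der a b) (X3 r s) = (2 * a + b) \<odot>\<^bsub>U\<^esub> X3 r s"
  "induced (degree_der a b) (X4 r s) = (3 * a + 2 * b) \<odot>\<^bsub>U\<^esub> X4 r s"
  "induced (degree_der a b) (X5 r s) = (a + b) \<odot>\<^bsub>U\<^esub> X5 r s"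
  "induced (degree_der a b) (X6 r s) = b \<odot>\<^bsub>U\<^esub> X6 r s"
  unfolding U_generators by (intro induced_degree_der homog_root_vectors homog_e1 homog_e2)+

lemma derivation_eqI:
  assumes "E \<in> derivations class_ring U" "F \<in> derivations class_ring U"
    and "E (X1 r s) = F (X1 r s)" "E (X6 r s) = F (X6 r s)"
  shows "E = F"
proof -
  obtain D D' where D: "mod_der D" "E = induced D" "mod_der D'" "F = induced D'"
    using assms(1,2) derivation_induced by metis
  have "D e1 - D' e1 \<in> rel_ideal r s" "D e2 - D' e2 \<in> rel_ideal r s"
    using assms(3,4) by (simp_all add: D U_generators induced_cls cls_eq_iff)
  then have "D x - D' x \<in> rel_ideal r s" for x
    by (rule vanish_on_generators[OF mod_der_diff[OF D(1,3)]])
  then show ?thesis by (simp add: D induced_eq_iff)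
qed

text \<open>Both derivations exist because the relations are homogeneous, and they are unique because a derivation
  is determined by its values on \<open>X\<^sub>1\<close> and \<open>X\<^sub>6\<close>.\<close>

lemma is_D5_iff: "is_D5 r s D \<longleftrightarrow> D = induced (degree_der 1 0)"
proof
  assume "is_D5 r s D"
  then show "D = induced (degree_der 1 0)"
    using induced_degree_der_root_vectors(1,6)[of 1 0]
    by (intro derivation_eqI induced_derivation mod_der_degree_der)
      (auto simp: is_D5_def U_generators U_simps)
next
  assume "D = induced (degree_der 1 0)"
  then show "is_D5 r s D"
    unfolding is_D5_def using induced_derivation[OF mod_der_degree_der[of 1 0]]
    by (simp add: induced_degree_der_root_vectors) (simp add: U_generators U_simps)
qed

lemma is_D6_iff: "is_D6 r s D \<longleftrightarrow> D = induced (degree_der (-1) 1)"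
proof
  assume "is_D6 r s D"
  then show "D = induced (degree_der (-1) 1)"
    using induced_degree_der_root_vectors(1,6)[of "-1" 1]
    by (intro derivation_eqI induced_derivation mod_der_degree_der)
      (auto simp: is_D6_def U_generators U_simps)
next
  assume "D = induced (degree_der (-1) 1)"
  then show "is_D6 r s D"
    unfolding is_D6_def using induced_derivation[OF mod_der_degree_der[of "-1" 1]]
    by (simp add: induced_degree_der_root_vectors) (simp add: U_generators U_simps)
qed

lemma D5_eq: "D5 r s = induced (degree_der 1 0)" and D6_eq: "D6 r s = induced (degree_der (-1) 1)"
  by (simp_all add: D5_def D6_def is_D5_iff is_D6_iff)

lemma degree_der_linear: "scale a (degree_der c d x) + scale b (degree_der c' d' x)
    = degree_der (a * c + b * c') (a * d + b * d') x"
proof (rule poly_mapping_eqI)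
  fix w
  have "sum_list (List.map (case_gen (a * c + b * c') (a * d + b * d')) l)
      = a * sum_list (List.map (case_gen c d) l) + b * sum_list (List.map (case_gen c' d') l)" for l
  proof (induction l)
    case (Cons g l) then show ?case by (cases g) (simp_all add: algebra_simps)
  qed simp
  then show "Poly_Mapping.lookup (scale a (degree_der c d x) + scale b (degree_der c' d' x)) w
      = Poly_Mapping.lookup (degree_der (a * c + b * c') (a * d + b * d') x) w"
    by (simp add: lookup_add lookup_scale degree_der_def lookup_weight_der deg_weight_def algebra_simps)
qed

text \<open>On a root vector, the component of degree zero of \<open>ad g\<close> comes from the constant term of \<open>g\<close>,
  and this is central.\<close>

lemma degree_der_not_inner:
  assumes "\<And>x. degree_der a b x - ad g x \<in> rel_ideal r s"
  shows "a = 0" "b = 0"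
proof -
  \<comment> \<open>The constant term is removed.\<close>
  define h where "h = g - scale (Poly_Mapping.lookup g 0) (Poly_Mapping.single 0 1)"
  have h: "h \<in> avoids 0" unfolding h_def
    by (rule remove_word_avoids) (simp add: deg_weight_eq_gen)
  have ad: "ad g x = ad h x" for x
    by (simp add: ad_def h_def algebra_simps scale_mult_left scale_mult_right)
  have "symbol (ad h (root_vec i)) (unit_exp i) = 0" for i
    unfolding ad_def using avoids_mult[OF h homog_root_vec[of i]]
    by (intro symbol_avoids[of _ "dgr (unit_exp i)"] avoids_diff) auto
  then have "symbol (ad g (root_vec i)) (unit_exp i) = 0" for i by (simp only: ad)
  moreover have "symbol (root_vec i) (unit_exp i) = lead_coeff i" for i
    using symbol_word(2)[of "unit_exp i" "[i]"] by simp
  moreover have "symbol (degree_der a b (root_vec i) - ad g (root_vec i)) (unit_exp i) = 0" for i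
    by (rule symbol_rel) (rule assms)
  ultimately have "symbol (degree_der a b (root_vec i)) (unit_exp i) = 0" for i by (simp add: symbol_diff)
  from this[of A1] this[of A6] \<open>\<And>i. symbol (root_vec i) (unit_exp i) = lead_coeff i\<close>[of A1]
    \<open>\<And>i. symbol (root_vec i) (unit_exp i) = lead_coeff i\<close>[of A6]
  show "a = 0" "b = 0" by (simp_all add: degree_der_e1 degree_der_e2 symbol_scale)
qed

section \<open>The first Hochschild cohomology\<close>

abbreviation H where "H \<equiv> HH1 class_ring U"

definition hh_class :: "(free_alg \<Rightarrow> free_alg) \<Rightarrow> (free_alg set \<Rightarrow> free_alg set) set" where
  "hh_class D = HH1_class class_ring U (induced D)"

lemma induced_in_Der: "mod_der D \<Longrightarrow> induced D \<in> carrier Der"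
  by (simp add: Der_carrier)

lemma vectorspace_H: "vectorspace class_ring H"
  unfolding HH1_def
  by (intro vectorspace.intro module_quot_module[OF module_Der submodule_inner] class_field)

lemma H_carrier: "carrier H = hh_class ` {D. mod_der D}"
  unfolding HH1_def quot_carrier[OF module_Der submodule_inner] Der_carrier
  by (simp add: image_image hh_class_def HH1_class_def)

lemma H_add: "mod_der D \<Longrightarrow> mod_der E \<Longrightarrow> hh_class D \<oplus>\<^bsub>H\<^esub> hh_class E = hh_class (\<lambda>x. D x + E x)"
  unfolding HH1_def hh_class_def HH1_class_def
  by (simp add: quot_add[OF module_Der submodule_inner] induced_in_Der Der_add)

lemma H_smult: "mod_der D \<Longrightarrow> c \<odot>\<^bsub>H\<^esub> hh_class D = hh_class (\<lambda>x. scale c (D x))"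
  unfolding HH1_def hh_class_def HH1_class_def
  by (simp add: quot_smult[OF module_Der submodule_inner] induced_in_Der Der_smult)

lemma H_zero: "\<zero>\<^bsub>H\<^esub> = hh_class (\<lambda>x. 0)"
  unfolding HH1_def hh_class_def HH1_class_def
  by (simp add: quot_zero[OF module_Der submodule_inner] Der_zero)

lemma hh_class_eq_iff:
  assumes "mod_der D" "mod_der E"
  shows "hh_class D = hh_class E \<longleftrightarrow> (\<exists>g. \<forall>x. D x - E x - ad g x \<in> rel_ideal r s)"
proof -
  interpret Module.module class_ring Der by (rule module_Der)
  have nE: "mod_der (\<lambda>x. - E x)" by (rule mod_der_minus[OF assms(2)])
  have "\<ominus>\<^bsub>Der\<^esub> induced E = induced (\<lambda>x. - E x)"
    by (rule M.minus_equality) (simp_all add: Der_add Der_zero assms nE induced_in_Der)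
  then have "induced D \<ominus>\<^bsub>Der\<^esub> induced E = induced (\<lambda>x. D x - E x)"
    by (simp add: a_minus_def Der_add assms nE)
  then have "hh_class D = hh_class E \<longleftrightarrow> induced (\<lambda>x. D x - E x) \<in> inner_derivations U"
    unfolding hh_class_def HH1_class_def
    by (simp add: quot_eq_iff[OF module_Der submodule_inner] induced_in_Der assms)
  also have "\<dots> \<longleftrightarrow> (\<exists>g. \<forall>x. D x - E x - ad g x \<in> rel_ideal r s)"
    by (simp add: inner_eq image_iff induced_eq_iff mod_der_diff assms mod_der_ad)
  finally show ?thesis .
qed

lemma hh_class_degree_der_eq_iff: "hh_class (degree_der a b) = hh_class (degree_der c d) \<longleftrightarrow> a = c \<and> b = d"
proof
  assume "hh_class (degree_der a b) = hh_class (degree_der c d)"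
  then obtain g where g: "\<And>x. degree_der a b x - degree_der c d x - ad g x \<in> rel_ideal r s"
    by (auto simp: hh_class_eq_iff mod_der_degree_der)
  have "degree_der (a - c) (b - d) x - ad g x \<in> rel_ideal r s" for x
    using g[of x] degree_der_linear[of 1 a b x "-1" c d] by (simp add: scale_minus_left)
  then show "a = c \<and> b = d" using degree_der_not_inner[of "a - c" "b - d" g] by auto
qed simp

lemma H_lincomb:
  "LinearCombinations.module.lincomb H k {hh_class (degree_der 1 0), hh_class (degree_der (-1) 1)}
    = hh_class (degree_der (k (hh_class (degree_der 1 0)) - k (hh_class (degree_der (-1) 1)))
        (k (hh_class (degree_der (-1) 1))))"
proof -
  interpret vectorspace class_ring H by (rule vectorspace_H)
  have c: "hh_class (degree_der a b) \<in> carrier H" for a b by (simp add: H_carrier mod_der_degree_der)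
  have ne: "hh_class (degree_der 1 0) \<noteq> hh_class (degree_der (-1) 1)" by (simp add: hh_class_degree_der_eq_iff)
  have "lincomb k {hh_class (degree_der 1 0), hh_class (degree_der (-1) 1)}
      = k (hh_class (degree_der 1 0)) \<odot>\<^bsub>H\<^esub> hh_class (degree_der 1 0)
        \<oplus>\<^bsub>H\<^esub> k (hh_class (degree_der (-1) 1)) \<odot>\<^bsub>H\<^esub> hh_class (degree_der (-1) 1)"
    unfolding lincomb_def using c ne by (subst M.finsum_insert) auto
  also have "\<dots> = hh_class (\<lambda>x. scale (k (hh_class (degree_der 1 0))) (degree_der 1 0 x)
      + scale (k (hh_class (degree_der (-1) 1))) (degree_der (-1) 1 x))"
    by (simp add: H_smult H_add mod_der_degree_der mod_der_scale)
  finally show ?thesis by (simp add: degree_der_linear)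
qed

lemma hh_class_degree_der_surj:
  assumes "Y \<in> carrier H" shows "\<exists>a b. Y = hh_class (degree_der a b)"
proof -
  obtain D where D: "mod_der D" "Y = hh_class D" using assms by (auto simp: H_carrier)
  obtain a b g where g: "\<And>x. D x - (scale a (degree_der 1 0 x) + scale b (degree_der 0 1 x) + ad g x) \<in> rel_ideal r s"
    using mod_der_decomposition[OF D(1)] by blast
  have eq: "scale a (degree_der 1 0 x) + scale b (degree_der 0 1 x) = degree_der a b x" for x
    using degree_der_linear[of a 1 0 x b 0 1] by simp
  have "D x - degree_der a b x - ad g x \<in> rel_ideal r s" for x
    using g[of x] unfolding eq by (simp add: diff_diff_eq)
  then show ?thesis using D by (auto simp: hh_class_eq_iff mod_der_degree_der)
qed

lemma H_basis: "vectorspace.basis class_ring H {hh_class (degree_der 1 0), hh_class (degree_der (-1) 1)}"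
proof -
  interpret vectorspace class_ring H by (rule vectorspace_H)
  let ?B = "{hh_class (degree_der 1 0), hh_class (degree_der (-1) 1)}"
  have B: "?B \<subseteq> carrier H" by (auto simp: H_carrier mod_der_degree_der)
  have ne: "hh_class (degree_der 1 0) \<noteq> hh_class (degree_der (-1) 1)" by (simp add: hh_class_degree_der_eq_iff)
  have "lin_indpt ?B"
  proof (rule finite_lin_indpt2)
    fix k assume "lincomb k ?B = \<zero>\<^bsub>H\<^esub>"
    moreover have "(\<lambda>x. 0) = degree_der 0 0"
      using degree_der_linear[of 0 0 0 _ 0 0 0] by auto
    ultimately show "\<forall>v\<in>?B. k v = \<zero>\<^bsub>class_ring\<^esub>"
      by (simp add: H_lincomb H_zero hh_class_degree_der_eq_iff)
  qed (use B in auto)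
  moreover have "span ?B = carrier H"
  proof
    show "span ?B \<subseteq> carrier H" using B by (rule span_is_subset2)
    show "carrier H \<subseteq> span ?B"
    proof
      fix Y assume "Y \<in> carrier H"
      then obtain a b where Y: "Y = hh_class (degree_der a b)" using hh_class_degree_der_surj by blast
      \<comment> \<open>The class of weight \<open>(a, b)\<close> is \<open>(a + b) D\<^sub>5 + b D\<^sub>6\<close>.\<close>
      define k where "k Z = (if Z = hh_class (degree_der 1 0) then a + b else b)" for Z
      have "lincomb k ?B = Y" using ne by (auto simp: H_lincomb Y k_def)
      then show "Y \<in> span ?B" unfolding span_def by (auto intro!: exI[of _ ?B] exI[of _ k])
    qed
  qed
  ultimately show ?thesis using B by (simp add: basis_def)
qed

end

theorem theorem3p6:
  fixes r s :: complex
  assumes "r \<noteq> 0" and "s \<noteq> 0"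
    and "\<And>m n :: int. r powi m * s powi n = 1 \<Longrightarrow> m = 0 \<and> n = 0"
  shows "(\<exists>!D. is_D5 r s D) \<and> (\<exists>!D. is_D6 r s D) \<and>
    vectorspace class_ring (HH1 class_ring (Uplus r s)) \<and>
    vectorspace.fin_dim class_ring (HH1 class_ring (Uplus r s)) \<and>
    vectorspace.dim class_ring (HH1 class_ring (Uplus r s)) = 2 \<and>
    LinearCombinations.module.span class_ring (HH1 class_ring (Uplus r s))
      {HH1_class class_ring (Uplus r s) (D5 r s), HH1_class class_ring (Uplus r s) (D6 r s)}
      = carrier (HH1 class_ring (Uplus r s))"
proof -
  interpret generic_parameters r s by standard (fact assms)+
  interpret V: vectorspace class_ring H by (rule vectorspace_H)
  let ?B = "{hh_class (degree_der 1 0), hh_class (degree_der (-1) 1)}"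
  have ne: "hh_class (degree_der 1 0) \<noteq> hh_class (degree_der (-1) 1)" by (simp add: hh_class_degree_der_eq_iff)
  have "V.span ?B = carrier H" "?B \<subseteq> carrier H"
    using H_basis by (auto simp: V.basis_def)
  moreover have "V.fin_dim"
    unfolding V.fin_dim_def using calculation by (intro exI[of _ ?B]) simp
  moreover have "V.dim = 2"
    using V.dim_basis[OF _ H_basis] ne by simp
  moreover have "\<exists>!D. is_D5 r s D" "\<exists>!D. is_D6 r s D"
    by (auto simp: is_D5_iff is_D6_iff)
  moreover have "HH1_class class_ring U (D5 r s) = hh_class (degree_der 1 0)"
    "HH1_class class_ring U (D6 r s) = hh_class (degree_der (-1) 1)"
    by (simp_all add: hh_class_def D5_eq D6_eq)
  ultimately show ?thesis using vectorspace_H by simp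
qed

end
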